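(* Let the Finsler space $(M,F)$, $\dim M=N\ge3$, be conformally automorphic to the Riemannian space $(M,S)$ with degree $H$ through the transformation $t=t(x,y)$, and let $$N^k{}_m=-y^k_i\left(\frac{\partial t^i}{\partial x^m}+a^i{}_{hm}t^h\right),\qquad N^k{}_{mn}=\frac{\partial N^k{}_m}{\partial y^n},\qquad N^k{}_{mnj}=\frac{\partial N^k{}_{mn}}{\partial y^j}.$$ If $d_mF=0$ and $H=\mathrm{const}$, then $$N^k{}_{mnj}=-\mathcal D_mC^k{}_{nj},$$ where $$\mathcal D_mC^k{}_{nj}:=d_mC^k{}_{nj}-N^k{}_{mt}C^t{}_{nj}+N^t{}_{mn}C^k{}_{tj}+N^t{}_{mj}C^k{}_{nt}$$ (in this last formula $t$ is a summation index).
   Context: $M$ is a $C^\infty$ manifold with local coordinates $x^i$; $y^i$ are the induced coordinates of tangent vectors $y\in T_xM\setminus0$; repeated indices are summed over $1,\dots,N$; considerations are local. The Finsler metric function $F(x,y)$ is smooth, positive, positively homogeneous of degree 1 in $y$, with positive-definite metric tensor $g_{ij}=\frac12\,\partial^2F^2/\partial y^i\partial y^j$, inverse $g^{ij}$. The Cartan tensor is $C_{knj}=\frac12\,\partial g_{kn}/\partial y^j$, and $C^k{}_{nj}=g^{kh}C_{hnj}$. $S(x,y)=\sqrt{a_{ij}(x)y^iy^j}$ is a Riemannian metric function and $a^i{}_{kn}(x)$ are the Christoffel symbols of $a_{ij}$. Definition. $(M,F)$ is conformally automorphic to $(M,S)$, of degree $H=H(x)>0$, if there is a smooth family of invertible smooth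 transformations $y\mapsto t=t(x,y)$ of nonzero tangent vectors at $x$ into nonzero tangent vectors at the same $x$ such that: (i) $t^m(x,ky)=k^{H}t^m(x,y)$ for all $k>0$; (ii) $F(x,y)=1\iff S(x,t(x,y))=1$; (iii) $g_{mn}(x,y)=p^2\,a_{ij}(x)\,t^i_m t^j_n$, where $t^i_m=\partial t^i/\partial y^m$ and $p=p(x,y)>0$. Notation: $y=y(x,t)$ is the inverse transformation and $y^k_i=\partial y^k/\partial t^i$, evaluated at $t=t(x,y)$; $d_m=\frac{\partial}{\partial x^m}+N^k{}_m\frac{\partial}{\partial y^k}$. *)

theory Defs
  imports "HOL-Analysis.Analysis"
begin

text \<open>
  The theory is local: the manifold is represented by an open set \<open>U\<close> of coordinate values,
  a point of the slit tangent bundle by a pair \<open>(x, y)\<close> with \<open>x \<in> U\<close>, \<open>y \<noteq> 0\<close>. Fields on the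
  slit tangent bundle are curried functions of \<open>x\<close> and \<open>y\<close>; component indices come first and are
  listed with upper indices before lower ones.
\<close>

section \<open>Smoothness and partial derivatives\<close>

primrec Ck_on :: "nat \<Rightarrow> ('a::real_normed_vector \<Rightarrow> 'b::real_normed_vector) \<Rightarrow> 'a set \<Rightarrow> bool" where
  "Ck_on 0 f S \<longleftrightarrow> continuous_on S f"
| "Ck_on (Suc k) f S \<longleftrightarrow>
     (\<forall>z\<in>S. f differentiable (at z)) \<and> (\<forall>v. Ck_on k (\<lambda>z. frechet_derivative f (at z) v) S)"

text \<open>Intended for open \<open>S\<close> only, since derivatives are taken in the whole space.\<close>

definition smooth_on :: "('a::real_normed_vector \<Rightarrow> 'b::real_normed_vector) \<Rightarrow> 'a set \<Rightarrow> bool" where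
  "smooth_on f S \<longleftrightarrow> (\<forall>k. Ck_on k f S)"

definition partial :: "'n \<Rightarrow> (real^'n \<Rightarrow> real) \<Rightarrow> real^'n \<Rightarrow> real" where
  "partial i f x = deriv (\<lambda>s. f (x + s *\<^sub>R axis i 1)) 0"

definition dx :: "'n \<Rightarrow> (real^'n \<Rightarrow> real^'n \<Rightarrow> real) \<Rightarrow> real^'n \<Rightarrow> real^'n \<Rightarrow> real" where
  "dx m f x y = partial m (\<lambda>z. f z y) x"

definition dy :: "'n \<Rightarrow> (real^'n \<Rightarrow> real^'n \<Rightarrow> real) \<Rightarrow> real^'n \<Rightarrow> real^'n \<Rightarrow> real" where
  "dy m f x y = partial m (\<lambda>z. f x z) y"

definition pos_def :: "real^'n^'n \<Rightarrow> bool" where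
  "pos_def A \<longleftrightarrow> (\<forall>v. v \<noteq> 0 \<longrightarrow> 0 < v \<bullet> (A *v v))"

section \<open>Finsler metrics\<close>

definition metric_tensor :: "(real^'n \<Rightarrow> real^'n \<Rightarrow> real) \<Rightarrow> real^'n \<Rightarrow> real^'n \<Rightarrow> real^'n^'n" where
  "metric_tensor F x y = (\<chi> i j. 1/2 * dy i (dy j (\<lambda>x y. (F x y)\<^sup>2)) x y)"

definition finsler_metric :: "(real^'n) set \<Rightarrow> (real^'n \<Rightarrow> real^'n \<Rightarrow> real) \<Rightarrow> bool" where
  "finsler_metric U F \<longleftrightarrow>
     smooth_on (\<lambda>(x, y). F x y) (U \<times> (- {0})) \<and>
     (\<forall>x\<in>U. \<forall>y. y \<noteq> 0 \<longrightarrow>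
        0 < F x y \<and> (\<forall>k>0. F x (k *\<^sub>R y) = k * F x y) \<and> pos_def (metric_tensor F x y))"

definition cartan :: "(real^'n \<Rightarrow> real^'n \<Rightarrow> real) \<Rightarrow> 'n \<Rightarrow> 'n \<Rightarrow> 'n \<Rightarrow> real^'n \<Rightarrow> real^'n \<Rightarrow> real" where
  "cartan F k n j x y = 1/2 * dy j (\<lambda>x y. metric_tensor F x y $ k $ n) x y"

text \<open>The mixed Cartan tensor \<open>C\<^sup>k\<^sub>n\<^sub>j = g\<^sup>k\<^sup>h C\<^sub>h\<^sub>n\<^sub>j\<close>.\<close>

definition cartan_up :: "(real^'n \<Rightarrow> real^'n \<Rightarrow> real) \<Rightarrow> 'n \<Rightarrow> 'n \<Rightarrow> 'n \<Rightarrow> real^'n \<Rightarrow> real^'n \<Rightarrow> real" where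
  "cartan_up F k n j x y =
     (\<Sum>h\<in>UNIV. matrix_inv (metric_tensor F x y) $ k $ h * cartan F h n j x y)"

section \<open>Riemannian metrics\<close>

definition riemannian_metric :: "(real^'n) set \<Rightarrow> (real^'n \<Rightarrow> real^'n^'n) \<Rightarrow> bool" where
  "riemannian_metric U a \<longleftrightarrow>
     smooth_on a U \<and> (\<forall>x\<in>U. transpose (a x) = a x \<and> pos_def (a x))"

definition riem_norm :: "(real^'n \<Rightarrow> real^'n^'n) \<Rightarrow> real^'n \<Rightarrow> real^'n \<Rightarrow> real" where
  "riem_norm a x y = sqrt (\<Sum>i\<in>UNIV. \<Sum>j\<in>UNIV. a x $ i $ j * y $ i * y $ j)"

definition christoffel :: "(real^'n \<Rightarrow> real^'n^'n) \<Rightarrow> 'n \<Rightarrow> 'n \<Rightarrow> 'n \<Rightarrow> real^'n \<Rightarrow> real" where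
  "christoffel a i k n x =
     1/2 * (\<Sum>h\<in>UNIV. matrix_inv (a x) $ i $ h *
       (partial k (\<lambda>z. a z $ h $ n) x + partial n (\<lambda>z. a z $ h $ k) x
          - partial h (\<lambda>z. a z $ k $ n) x))"

section \<open>Conformal automorphisms\<close>

text \<open>
  \<open>F\<close> is the Finsler metric function, \<open>a\<close> the Riemannian metric tensor, \<open>H\<close> the degree and \<open>t\<close>
  the transformation. Only \<open>t\<close> itself is required to be smooth: the conformality condition makes
  its Jacobian invertible, so smoothness of the inverse is automatic.
\<close>

definition conformally_automorphic_via ::
  "(real^'n) set \<Rightarrow> (real^'n \<Rightarrow> real^'n \<Rightarrow> real) \<Rightarrow> (real^'n \<Rightarrow> real^'n^'n) \<Rightarrow>
   (real^'n \<Rightarrow> real) \<Rightarrow> (real^'n \<Rightarrow> real^'n \<Rightarrow> real^'n) \<Rightarrow> bool" where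
  "conformally_automorphic_via U F a H t \<longleftrightarrow>
     (\<forall>x\<in>U. 0 < H x) \<and>
     smooth_on (\<lambda>(x, y). t x y) (U \<times> (- {0})) \<and>
     (\<forall>x\<in>U. bij_betw (t x) (- {0}) (- {0})) \<and>
     (\<forall>x\<in>U. \<forall>y. y \<noteq> 0 \<longrightarrow> (\<forall>k>0. \<forall>m. t x (k *\<^sub>R y) $ m = k powr H x * t x y $ m)) \<and>
     (\<forall>x\<in>U. \<forall>y. y \<noteq> 0 \<longrightarrow> (F x y = 1 \<longleftrightarrow> riem_norm a x (t x y) = 1)) \<and>
     (\<exists>p :: real^'n \<Rightarrow> real^'n \<Rightarrow> real. \<forall>x\<in>U. \<forall>y. y \<noteq> 0 \<longrightarrow>
        0 < p x y \<and>
        (\<forall>m n. metric_tensor F x y $ m $ n =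
           (p x y)\<^sup>2 * (\<Sum>i\<in>UNIV. \<Sum>j\<in>UNIV.
              a x $ i $ j * dy m (\<lambda>x y. t x y $ i) x y * dy n (\<lambda>x y. t x y $ j) x y)))"

definition inv_transf :: "(real^'n \<Rightarrow> real^'n \<Rightarrow> real^'n) \<Rightarrow> real^'n \<Rightarrow> real^'n \<Rightarrow> real^'n" where
  "inv_transf t x = the_inv_into (- {0}) (t x)"

text \<open>\<open>y\<^sup>k\<^sub>i = \<partial>y\<^sup>k/\<partial>t\<^sup>i\<close>, evaluated at \<open>t = t(x, y)\<close>.\<close>

definition inv_jacobian ::
  "(real^'n \<Rightarrow> real^'n \<Rightarrow> real^'n) \<Rightarrow> 'n \<Rightarrow> 'n \<Rightarrow> real^'n \<Rightarrow> real^'n \<Rightarrow> real" where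
  "inv_jacobian t k i x y = partial i (\<lambda>\<tau>. inv_transf t x \<tau> $ k) (t x y)"

section \<open>The connection coefficients and covariant derivative\<close>

definition conn ::
  "(real^'n \<Rightarrow> real^'n^'n) \<Rightarrow> (real^'n \<Rightarrow> real^'n \<Rightarrow> real^'n) \<Rightarrow> 'n \<Rightarrow> 'n \<Rightarrow>
   real^'n \<Rightarrow> real^'n \<Rightarrow> real" where
  "conn a t k m x y =
     - (\<Sum>i\<in>UNIV. inv_jacobian t k i x y *
          (dx m (\<lambda>x y. t x y $ i) x y + (\<Sum>h\<in>UNIV. christoffel a i h m x * t x y $ h)))"

text \<open>\<open>N\<^sup>k\<^sub>m\<^sub>n = \<partial>N\<^sup>k\<^sub>m/\<partial>y\<^sup>n\<close> and \<open>N\<^sup>k\<^sub>m\<^sub>n\<^sub>j = \<partial>N\<^sup>k\<^sub>m\<^sub>n/\<partial>y\<^sup>j\<close>.\<close>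

definition conn2 ::
  "(real^'n \<Rightarrow> real^'n^'n) \<Rightarrow> (real^'n \<Rightarrow> real^'n \<Rightarrow> real^'n) \<Rightarrow> 'n \<Rightarrow> 'n \<Rightarrow> 'n \<Rightarrow>
   real^'n \<Rightarrow> real^'n \<Rightarrow> real" where
  "conn2 a t k m n = dy n (conn a t k m)"

definition conn3 ::
  "(real^'n \<Rightarrow> real^'n^'n) \<Rightarrow> (real^'n \<Rightarrow> real^'n \<Rightarrow> real^'n) \<Rightarrow> 'n \<Rightarrow> 'n \<Rightarrow> 'n \<Rightarrow> 'n \<Rightarrow>
   real^'n \<Rightarrow> real^'n \<Rightarrow> real" where
  "conn3 a t k m n j = dy j (conn2 a t k m n)"

definition d_op ::
  "(real^'n \<Rightarrow> real^'n^'n) \<Rightarrow> (real^'n \<Rightarrow> real^'n \<Rightarrow> real^'n) \<Rightarrow> 'n \<Rightarrow>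
   (real^'n \<Rightarrow> real^'n \<Rightarrow> real) \<Rightarrow> real^'n \<Rightarrow> real^'n \<Rightarrow> real" where
  "d_op a t m f x y = dx m f x y + (\<Sum>k\<in>UNIV. conn a t k m x y * dy k f x y)"

text \<open>
  \<open>\<D>\<^sub>m C\<^sup>k\<^sub>n\<^sub>j\<close>. The coefficients enter with signs opposite to the usual Christoffel ones because
  \<open>N\<^sup>k\<^sub>m\<close> itself is defined with a minus sign.
\<close>

definition cov_cartan ::
  "(real^'n \<Rightarrow> real^'n \<Rightarrow> real) \<Rightarrow> (real^'n \<Rightarrow> real^'n^'n) \<Rightarrow> (real^'n \<Rightarrow> real^'n \<Rightarrow> real^'n) \<Rightarrow>
   'n \<Rightarrow> 'n \<Rightarrow> 'n \<Rightarrow> 'n \<Rightarrow> real^'n \<Rightarrow> real^'n \<Rightarrow> real" where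
  "cov_cartan F a t m k n j x y =
     d_op a t m (cartan_up F k n j) x y
     - (\<Sum>s\<in>UNIV. conn2 a t k m s x y * cartan_up F s n j x y)
     + (\<Sum>s\<in>UNIV. conn2 a t s m n x y * cartan_up F k s j x y)
     + (\<Sum>s\<in>UNIV. conn2 a t s m j x y * cartan_up F k n s x y)"

end

theory Submission
  imports Defs
begin

text \<open>
  The coefficients \<open>N\<^sup>k\<^sub>m\<close> are made so that \<open>d\<^sub>m t\<^sup>i = - a\<^sup>i\<^sub>h\<^sub>m t\<^sup>h\<close>. Differentiating this in \<open>y\<^sup>n\<close>, with
  \<open>[\<partial>/\<partial>y\<^sup>n, d\<^sub>m] = N\<^sup>k\<^sub>m\<^sub>n \<partial>/\<partial>y\<^sup>k\<close>, gives the horizontal derivative of the Jacobian. By Euler's theorem the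
  conformal factor is \<open>p\<^sup>2 = F\<^sup>2 / (H\<^sup>2 S\<^sup>2(t))\<close>, which \<open>d\<^sub>m\<close> annihilates, so \<open>\<D>\<^sub>m g\<^sub>j\<^sub>n = 0\<close>. Differentiating
  once more, in \<open>y\<^sup>h\<close>, yields \<open>2 \<D>\<^sub>m C\<^sub>j\<^sub>n\<^sub>h = - (g\<^sub>n\<^sub>k N\<^sup>k\<^sub>m\<^sub>j\<^sub>h + g\<^sub>j\<^sub>k N\<^sup>k\<^sub>m\<^sub>n\<^sub>h)\<close>. As \<open>N\<^sup>k\<^sub>m\<^sub>j\<^sub>h\<close> is symmetric in \<open>j, h\<close>
  and \<open>C\<close> is totally symmetric, the Christoffel trick solves this for \<open>N\<^sup>k\<^sub>m\<^sub>j\<^sub>h\<close>.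
\<close>

section \<open>Functions of class \<open>C\<^sup>k\<close>\<close>

text \<open>Derivatives at points of an open set see only nearby values, so agreement on
  \<open>S\<close> is enough. This allows a field to be replaced by a formula that holds only over
  the slit bundle, whatever the values elsewhere.\<close>

lemma Ck_on_cong:
  assumes "open S" "\<And>z. z \<in> S \<Longrightarrow> f z = g z" "Ck_on k f S"
  shows "Ck_on k g S"
  using assms(2,3)
proof (induction k arbitrary: f g)
  case 0
  then show ?case by (simp cong: continuous_on_cong)
next
  case (Suc k)
  have diff: "f differentiable (at z)" if "z \<in> S" for z
    using Suc.prems that by simp
  have "g differentiable (at z)" if "z \<in> S" for z
    using diff[OF that] Suc.prems(1) \<open>open S\<close> that
    by (meson differentiable_def has_derivative_transform_within_open)
  moreover have "frechet_derivative f (at z) v = frechet_derivative g (at z) v" if "z \<in> S" for z v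
    using frechet_derivative_transform_within_open[OF diff[OF that] \<open>open S\<close> that Suc.prems(1)] by simp
  moreover have "Ck_on k (\<lambda>z. frechet_derivative g (at z) v) S" for v
    by (rule Suc.IH[of "\<lambda>z. frechet_derivative f (at z) v"]) (use calculation(2) Suc.prems(2) in auto)
  ultimately show ?case by simp
qed

text \<open>Derivatives at a point are unique, so any exhibited derivative may stand in for the one
  chosen by \<open>frechet_derivative\<close>.\<close>

lemma Ck_on_SucI:
  assumes "open S" "\<And>z. z \<in> S \<Longrightarrow> (f has_derivative f' z) (at z)"
    and "\<And>v. Ck_on k (\<lambda>z. f' z v) S"
  shows "Ck_on (Suc k) f S"
proof -
  have "f differentiable (at z)" if "z \<in> S" for z
    using assms(2)[OF that] by (rule differentiableI)
  moreover have "f' z v = frechet_derivative f (at z) v" if "z \<in> S" for z v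
    using frechet_derivative_at[OF assms(2)[OF that]] by simp
  ultimately show ?thesis
    using Ck_on_cong[OF assms(1) _ assms(3)] by simp
qed

lemma Ck_on_SucD:
  assumes "Ck_on (Suc k) f S"
  shows "\<And>z. z \<in> S \<Longrightarrow> (f has_derivative frechet_derivative f (at z)) (at z)"
    and "\<And>v. Ck_on k (\<lambda>z. frechet_derivative f (at z) v) S"
  using assms by (auto simp: frechet_derivative_works)

lemma Ck_on_decr: "Ck_on (Suc k) f S \<Longrightarrow> Ck_on k f S"
proof (induction k arbitrary: f)
  case 0
  then show ?case
    by (auto intro!: differentiable_imp_continuous_on differentiable_at_imp_differentiable_on)
next
  case (Suc k)
  then show ?case by (metis Ck_on.simps(2))
qed

section \<open>Closure properties of the class C^k\<close>

lemma Ck_on_const: "open S \<Longrightarrow> Ck_on k (\<lambda>z. c) S"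
  by (induction k arbitrary: c) (auto intro!: Ck_on_SucI derivative_intros)

lemma Ck_on_add:
  assumes "open S"
  shows "Ck_on k f S \<Longrightarrow> Ck_on k g S \<Longrightarrow> Ck_on k (\<lambda>z. f z + g z) S"
proof (induction k arbitrary: f g)
  case 0
  then show ?case by (auto intro: continuous_intros)
next
  case (Suc k)
  show ?case
    by (rule Ck_on_SucI[OF assms has_derivative_add[OF Suc.prems[THEN Ck_on_SucD(1)]]])
       (auto intro: Suc.IH Suc.prems[THEN Ck_on_SucD(2)])
qed

lemma Ck_on_mult:
  fixes f g :: "'a::real_normed_vector \<Rightarrow> real"
  assumes "open S"
  shows "Ck_on k f S \<Longrightarrow> Ck_on k g S \<Longrightarrow> Ck_on k (\<lambda>z. f z * g z) S"
proof (induction k arbitrary: f g)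
  case 0
  then show ?case by (auto intro: continuous_intros)
next
  case (Suc k)
  show ?case
    by (rule Ck_on_SucI[OF assms has_derivative_mult[OF Suc.prems[THEN Ck_on_SucD(1)]]])
       (auto intro!: Ck_on_add[OF assms] Suc.IH Suc.prems[THEN Ck_on_SucD(2)] Suc.prems[THEN Ck_on_decr])
qed

lemma Ck_on_inverse:
  fixes f :: "'a::real_normed_vector \<Rightarrow> real"
  assumes "open S" "\<And>z. z \<in> S \<Longrightarrow> f z \<noteq> 0"
  shows "Ck_on k f S \<Longrightarrow> Ck_on k (\<lambda>z. inverse (f z)) S"
proof (induction k)
  case 0
  then show ?case using assms by (auto intro: continuous_intros)
next
  case (Suc k)
  note inv = Suc.IH[OF Ck_on_decr[OF Suc.prems]]
  \<comment> \<open>The derivative of \<open>1/f\<close> along \<open>v\<close>, written with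
    products only. The inverse occurs in it again, but only to order \<open>k\<close>, which is the
    induction hypothesis.\<close>
  have "Ck_on k (\<lambda>z. - 1 * (inverse (f z) * frechet_derivative f (at z) v * inverse (f z))) S" for v
    by (intro Ck_on_mult Ck_on_const assms(1) inv Ck_on_SucD(2)[OF Suc.prems])
  then show ?case
    by (intro Ck_on_SucI[OF assms(1) Deriv.has_derivative_inverse[OF assms(2) Ck_on_SucD(1)[OF Suc.prems]]])
       simp_all
qed

text \<open>With a linear inner map, the derivative along \<open>v\<close> is the derivative of
  \<open>f\<close> along the fixed vector \<open>L v\<close>, so the induction closes without a
  general chain rule. With a projection as \<open>L\<close>, it turns functions of \<open>x\<close>
  alone into fields.\<close>

lemma Ck_on_compose_linear:
  assumes "open S" "bounded_linear L" "\<And>z. z \<in> S \<Longrightarrow> L z \<in> R"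
  shows "Ck_on k f R \<Longrightarrow> Ck_on k (\<lambda>z. f (L z)) S"
proof (induction k arbitrary: f)
  case 0
  then show ?case
    using assms linear_continuous_on[OF assms(2)]
    by (auto intro: continuous_on_compose2)
next
  case (Suc k)
  show ?case
  proof (rule Ck_on_SucI[OF assms(1)])
    show "((\<lambda>z. f (L z)) has_derivative (\<lambda>v. frechet_derivative f (at (L z)) (L v))) (at z)"
      if "z \<in> S" for z
      using has_derivative_compose[OF bounded_linear_imp_has_derivative[OF assms(2)]
          Ck_on_SucD(1)[OF Suc.prems assms(3)[OF that]]] .
  qed (rule Suc.IH[OF Ck_on_SucD(2)[OF Suc.prems]])
qed

lemma Ck_on_linear_compose:
  assumes "open S" "bounded_linear L"
  shows "Ck_on k f S \<Longrightarrow> Ck_on k (\<lambda>z. L (f z)) S"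
proof (induction k arbitrary: f)
  case 0
  then show ?case
    using bounded_linear.continuous_on[OF assms(2)] by auto
next
  case (Suc k)
  show ?case
    by (rule Ck_on_SucI[OF assms(1) bounded_linear.has_derivative[OF assms(2) Ck_on_SucD(1)[OF Suc.prems]]])
       (auto intro: Suc.IH Ck_on_SucD(2)[OF Suc.prems])
qed

text \<open>The mean value theorem is applied twice: along \<open>v\<close> to the difference of
  \<open>f\<close> across the step \<open>s *\<^sub>R w\<close>, then along \<open>w\<close> to the
  derivative so obtained.\<close>

lemma second_difference:
  fixes f :: "'a::real_normed_vector \<Rightarrow> real"
  assumes C2: "Ck_on 2 f S" and "s > 0"
    and S: "\<And>\<alpha> \<beta>. \<lbrakk>0 \<le> \<alpha>; \<alpha> \<le> s; 0 \<le> \<beta>; \<beta> \<le> s\<rbrakk> \<Longrightarrow> z + \<alpha> *\<^sub>R v + \<beta> *\<^sub>R w \<in> S"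
  shows "\<exists>\<alpha> \<beta>. 0 < \<alpha> \<and> \<alpha> < s \<and> 0 < \<beta> \<and> \<beta> < s \<and>
    f (z + s *\<^sub>R v + s *\<^sub>R w) - f (z + s *\<^sub>R v) - f (z + s *\<^sub>R w) + f z =
    s * (s * frechet_derivative (\<lambda>z. frechet_derivative f (at z) v) (at (z + \<alpha> *\<^sub>R v + \<beta> *\<^sub>R w)) w)"
proof -
  let ?f1 = "\<lambda>z. frechet_derivative f (at z) v"
  let ?f2 = "\<lambda>z. frechet_derivative ?f1 (at z) w"
  have C1: "Ck_on (Suc 0) ?f1 S" and C2': "Ck_on (Suc (Suc 0)) f S"
    using C2 by (auto simp: numeral_2_eq_2)
  have line: "((\<lambda>\<alpha>. h (c + \<alpha> *\<^sub>R u)) has_field_derivative frechet_derivative h (at (c + \<alpha> *\<^sub>R u)) u) (at \<alpha>)"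
    if "Ck_on (Suc k) h S" "c + \<alpha> *\<^sub>R u \<in> S" for h :: "'a \<Rightarrow> real" and k c \<alpha> u
  proof -
    have "((\<lambda>\<alpha>. h (c + \<alpha> *\<^sub>R u)) has_derivative (\<lambda>r. frechet_derivative h (at (c + \<alpha> *\<^sub>R u)) (r *\<^sub>R u))) (at \<alpha>)"
      by (rule has_derivative_compose[where f = "\<lambda>\<alpha>. c + \<alpha> *\<^sub>R u" and g = h, OF _ Ck_on_SucD(1)[OF that]])
         (auto intro!: derivative_eq_intros)
    moreover have "frechet_derivative h (at (c + \<alpha> *\<^sub>R u)) (r *\<^sub>R u) = frechet_derivative h (at (c + \<alpha> *\<^sub>R u)) u * r" for r
      using has_derivative_linear[OF Ck_on_SucD(1)[OF that]] by (simp add: linear_cmul)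
    ultimately show ?thesis
      by (simp add: has_field_derivative_def)
  qed
  let ?p = "\<lambda>\<alpha>. f (z + s *\<^sub>R w + \<alpha> *\<^sub>R v) - f (z + \<alpha> *\<^sub>R v)"
  have "(?p has_field_derivative ?f1 (z + s *\<^sub>R w + \<alpha> *\<^sub>R v) - ?f1 (z + \<alpha> *\<^sub>R v)) (at \<alpha>)"
    if "0 \<le> \<alpha>" "\<alpha> \<le> s" for \<alpha>
    using S[OF that, of s] S[OF that, of 0] \<open>s > 0\<close>
    by (intro DERIV_diff line[OF C2']) (auto simp: algebra_simps)
  from MVT2[OF \<open>s > 0\<close> this] obtain \<alpha> where \<alpha>: "0 < \<alpha>" "\<alpha> < s"
    and eq1: "?p s - ?p 0 = (s - 0) * (?f1 (z + s *\<^sub>R w + \<alpha> *\<^sub>R v) - ?f1 (z + \<alpha> *\<^sub>R v))"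
    by blast
  have "((\<lambda>\<beta>. ?f1 (z + \<alpha> *\<^sub>R v + \<beta> *\<^sub>R w)) has_field_derivative ?f2 (z + \<alpha> *\<^sub>R v + \<beta> *\<^sub>R w)) (at \<beta>)"
    if "0 \<le> \<beta>" "\<beta> \<le> s" for \<beta>
    using S[of \<alpha> \<beta>] \<alpha> that by (intro line[OF C1]) auto
  from MVT2[OF \<open>s > 0\<close> this] obtain \<beta> where \<beta>: "0 < \<beta>" "\<beta> < s"
    and eq2: "?f1 (z + \<alpha> *\<^sub>R v + s *\<^sub>R w) - ?f1 (z + \<alpha> *\<^sub>R v + 0 *\<^sub>R w)
      = (s - 0) * ?f2 (z + \<alpha> *\<^sub>R v + \<beta> *\<^sub>R w)"
    by blast
  have "?p s - ?p 0 = s * (s * ?f2 (z + \<alpha> *\<^sub>R v + \<beta> *\<^sub>R w))"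
    using eq1 eq2 by (simp add: ac_simps)
  then show ?thesis
    using \<alpha> \<beta> by (intro exI[of _ \<alpha>] exI[of _ \<beta>]) (simp add: ac_simps)
qed

text \<open>Schwarz's theorem. The second difference over a small parallelogram is symmetric in
  \<open>v\<close> and \<open>w\<close>, and by \<open>second_difference\<close> it is
  \<open>s * s\<close> times either mixed derivative at some point of the parallelogram. Both mixed
  derivatives are continuous at \<open>z\<close>, so their values there differ by at most
  \<open>2 * e\<close>.\<close>

lemma frechet_derivative_commute:
  fixes f :: "'a::real_normed_vector \<Rightarrow> real"
  assumes "open S" and C2: "Ck_on 2 f S" and "z \<in> S"
  shows "frechet_derivative (\<lambda>z. frechet_derivative f (at z) v) (at z) w =
         frechet_derivative (\<lambda>z. frechet_derivative f (at z) w) (at z) v"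
proof -
  let ?P = "\<lambda>v w z. frechet_derivative (\<lambda>z. frechet_derivative f (at z) v) (at z) w"
  have "\<bar>?P v w z - ?P w v z\<bar> \<le> 2 * e" if "e > 0" for e :: real
  proof -
    have "continuous_on S (?P v w)" "continuous_on S (?P w v)"
      using C2 by (simp_all add: numeral_2_eq_2)
    then have "isCont (?P v w) z" "isCont (?P w v) z"
      using \<open>open S\<close> \<open>z \<in> S\<close> by (simp_all add: continuous_on_eq_continuous_at)
    then obtain d1 d2 where d: "d1 > 0" "d2 > 0"
      "\<And>z'. dist z' z < d1 \<Longrightarrow> dist (?P v w z') (?P v w z) < e"
      "\<And>z'. dist z' z < d2 \<Longrightarrow> dist (?P w v z') (?P w v z) < e"
      unfolding continuous_at_eps_delta using \<open>e > 0\<close> by metis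
    obtain d3 where d3: "d3 > 0" "ball z d3 \<subseteq> S"
      using \<open>open S\<close> \<open>z \<in> S\<close> openE by blast
    define r where "r = min d1 (min d2 d3)"
    \<comment> \<open>Small enough that the parallelogram with sides \<open>s *\<^sub>R v\<close>
      and \<open>s *\<^sub>R w\<close> stays within \<open>r\<close> of \<open>z\<close>; the
      summand 1 keeps the denominator positive when both directions vanish.\<close>
    define s where "s = r / (norm v + norm w + 1)"
    have "r > 0" using d d3 by (simp add: r_def)
    have pos: "norm v + norm w + 1 > 0" by (smt (verit) norm_ge_zero)
    then have "s > 0" using \<open>r > 0\<close> by (simp add: s_def)
    have near: "dist (z + \<alpha> *\<^sub>R v + \<beta> *\<^sub>R w) z < r"
      if "0 \<le> \<alpha>" "\<alpha> \<le> s" "0 \<le> \<beta>" "\<beta> \<le> s" for \<alpha> \<beta>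
    proof -
      have "dist (z + \<alpha> *\<^sub>R v + \<beta> *\<^sub>R w) z = norm (\<alpha> *\<^sub>R v + \<beta> *\<^sub>R w)"
        by (simp add: dist_norm)
      also have "\<dots> \<le> \<alpha> * norm v + \<beta> * norm w"
        using norm_triangle_ineq[of "\<alpha> *\<^sub>R v" "\<beta> *\<^sub>R w"] that by simp
      also have "\<dots> \<le> s * norm v + s * norm w"
        using that by (intro add_mono mult_right_mono) auto
      also have "\<dots> < s * (norm v + norm w + 1)"
        using \<open>s > 0\<close> by (simp add: algebra_simps)
      also have "\<dots> = r" using pos by (simp add: s_def)
      finally show ?thesis .
    qed
    have inS: "z + \<alpha> *\<^sub>R v + \<beta> *\<^sub>R w \<in> S"
      if "0 \<le> \<alpha>" "\<alpha> \<le> s" "0 \<le> \<beta>" "\<beta> \<le> s" for \<alpha> \<beta>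
      using near[OF that] d3 by (auto simp: r_def dist_commute subset_iff)
    obtain \<alpha> \<beta> where 1: "0 < \<alpha>" "\<alpha> < s" "0 < \<beta>" "\<beta> < s"
      "f (z + s *\<^sub>R v + s *\<^sub>R w) - f (z + s *\<^sub>R v) - f (z + s *\<^sub>R w) + f z =
        s * (s * ?P v w (z + \<alpha> *\<^sub>R v + \<beta> *\<^sub>R w))"
      using second_difference[OF C2 \<open>s > 0\<close> inS] by blast
    have inS': "z + \<alpha> *\<^sub>R w + \<beta> *\<^sub>R v \<in> S"
      if "0 \<le> \<alpha>" "\<alpha> \<le> s" "0 \<le> \<beta>" "\<beta> \<le> s" for \<alpha> \<beta>
      using inS[OF that(3,4,1,2)] by (simp add: ac_simps)
    obtain \<gamma> \<delta> where 2: "0 < \<gamma>" "\<gamma> < s" "0 < \<delta>" "\<delta> < s"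
      "f (z + s *\<^sub>R w + s *\<^sub>R v) - f (z + s *\<^sub>R w) - f (z + s *\<^sub>R v) + f z =
        s * (s * ?P w v (z + \<gamma> *\<^sub>R w + \<delta> *\<^sub>R v))"
      using second_difference[OF C2 \<open>s > 0\<close> inS'] by blast
    have "z + s *\<^sub>R w + s *\<^sub>R v = z + s *\<^sub>R v + s *\<^sub>R w"
      by (simp add: ac_simps)
    then have "s * (s * ?P v w (z + \<alpha> *\<^sub>R v + \<beta> *\<^sub>R w)) = s * (s * ?P w v (z + \<gamma> *\<^sub>R w + \<delta> *\<^sub>R v))"
      using 1(5) 2(5) by (simp only:)
    then have eq: "?P v w (z + \<alpha> *\<^sub>R v + \<beta> *\<^sub>R w) = ?P w v (z + \<delta> *\<^sub>R v + \<gamma> *\<^sub>R w)"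
      using \<open>s > 0\<close> by (simp add: ac_simps)
    have "dist (?P v w (z + \<alpha> *\<^sub>R v + \<beta> *\<^sub>R w)) (?P v w z) < e"
      by (rule d(3)) (use near[of \<alpha> \<beta>] 1 in \<open>simp add: r_def\<close>)
    moreover have "dist (?P w v (z + \<delta> *\<^sub>R v + \<gamma> *\<^sub>R w)) (?P w v z) < e"
      by (rule d(4)) (use near[of \<delta> \<gamma>] 2 in \<open>simp add: r_def\<close>)
    ultimately show ?thesis
      using eq by (simp add: dist_real_def)
  qed
  then have "\<bar>?P v w z - ?P w v z\<bar> \<le> 0"
    using dense_ge[of 0 "\<bar>?P v w z - ?P w v z\<bar> / 2"] by (simp add: mult.commute)
  then show ?thesis by simp
qed

section \<open>Smooth fields on the slit tangent bundle\<close>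

text \<open>The derivative along a vector of the product space. The operators \<open>dx\<close>,
  \<open>dy\<close> and \<open>d_op\<close> are all of this form at a given point, so sum, product,
  locality and commutation rules are proved once, for \<open>fderiv\<close>.\<close>

definition fderiv :: "(real^'n) \<times> (real^'n) \<Rightarrow> (real^'n \<Rightarrow> real^'n \<Rightarrow> real) \<Rightarrow>
    real^'n \<Rightarrow> real^'n \<Rightarrow> real" where
  "fderiv v f x y = frechet_derivative (\<lambda>(x, y). f x y) (at (x, y)) v"

definition smooth_field :: "(real^'n) set \<Rightarrow> (real^'n \<Rightarrow> real^'n \<Rightarrow> real) \<Rightarrow> bool" where
  "smooth_field U f \<longleftrightarrow> smooth_on (\<lambda>(x, y). f x y) (U \<times> (- {0}))"

lemma sum_axis: "(\<Sum>k\<in>UNIV. c k *\<^sub>R axis k (1::real)) = (\<chi> k. c k)"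
  by (simp add: vec_eq_iff axis_def if_distrib cong: if_cong)

lemma smooth_fieldD: "smooth_field U f \<Longrightarrow> Ck_on k (\<lambda>(x, y). f x y) (U \<times> (- {0}))"
  by (simp add: smooth_field_def smooth_on_def)

lemma has_derivative_fderiv:
  assumes "smooth_field U f" "x \<in> U" "y \<noteq> 0"
  shows "((\<lambda>(x, y). f x y) has_derivative (\<lambda>v. fderiv v f x y)) (at (x, y))"
  using Ck_on_SucD(1)[OF smooth_fieldD[OF assms(1)], of "(x, y)"] assms(2,3)
  by (simp add: fderiv_def)

lemma smooth_field_fderiv: "smooth_field U f \<Longrightarrow> smooth_field U (fderiv v f)"
  using Ck_on_SucD(2)[OF smooth_fieldD[of U f]]
  by (auto simp: smooth_field_def smooth_on_def fderiv_def case_prod_beta' cong: prod.case_cong)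

lemma fderiv_lincomb:
  fixes f :: "real^'n \<Rightarrow> real^'n \<Rightarrow> real"
  assumes "smooth_field U f" "x \<in> U" "y \<noteq> 0"
  shows "fderiv (axis m 1, \<chi> k. c k) f x y =
    fderiv (axis m 1, 0) f x y + (\<Sum>k\<in>UNIV. c k * fderiv (0, axis k 1) f x y)"
proof -
  note lin = has_derivative_linear[OF has_derivative_fderiv[OF assms]]
  have fst_sum: "fst (\<Sum>k\<in>A. c k *\<^sub>R (0, axis k 1)) = (0 :: real^'n)"
    and snd_sum: "snd (\<Sum>k\<in>A. c k *\<^sub>R ((0 :: real^'n), axis k 1)) = (\<Sum>k\<in>A. c k *\<^sub>R axis k 1)"
    for A :: "'n set"
    by (induction A rule: infinite_finite_induct) auto
  have "(axis m 1, \<chi> k. c k) = (axis m 1, 0) + (\<Sum>k\<in>UNIV. c k *\<^sub>R ((0 :: real^'n), axis k (1::real)))"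
    by (rule prod_eqI) (simp_all only: fst_add snd_add fst_conv snd_conv fst_sum snd_sum sum_axis add_0 add_0_right)
  then show ?thesis
    by (simp only: linear_add[OF lin] linear_sum[OF lin] linear_cmul[OF lin] real_scaleR_def)
qed

lemma dx_eq_fderiv:
  assumes "smooth_field U f" "x \<in> U" "y \<noteq> 0"
  shows "dx m f x y = fderiv (axis m 1, 0) f x y"
proof -
  note der = has_derivative_fderiv[OF assms]
  have "((\<lambda>s. (x + s *\<^sub>R axis m 1, y)) has_derivative (\<lambda>s. (s *\<^sub>R axis m 1, 0))) (at 0)"
    by (auto intro!: derivative_eq_intros)
  from has_derivative_compose[OF this, of "\<lambda>(x, y). f x y" "\<lambda>v. fderiv v f x y"] der
  have "((\<lambda>s. f (x + s *\<^sub>R axis m 1) y) has_derivative (\<lambda>s. fderiv (s *\<^sub>R axis m 1, 0) f x y)) (at 0)"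
    by simp
  moreover have "fderiv (s *\<^sub>R axis m 1, 0) f x y = fderiv (axis m 1, 0) f x y * s" for s
    using linear_cmul[OF has_derivative_linear[OF der], of s "(axis m 1, 0)"] by simp
  ultimately show ?thesis
    by (auto simp: dx_def partial_def has_field_derivative_def intro!: DERIV_imp_deriv)
qed

lemma dy_eq_fderiv:
  assumes "smooth_field U f" "x \<in> U" "y \<noteq> 0"
  shows "dy m f x y = fderiv (0, axis m 1) f x y"
proof -
  note der = has_derivative_fderiv[OF assms]
  have "((\<lambda>s. (x, y + s *\<^sub>R axis m 1)) has_derivative (\<lambda>s. (0, s *\<^sub>R axis m 1))) (at 0)"
    by (auto intro!: derivative_eq_intros)
  from has_derivative_compose[OF this, of "\<lambda>(x, y). f x y" "\<lambda>v. fderiv v f x y"] der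
  have "((\<lambda>s. f x (y + s *\<^sub>R axis m 1)) has_derivative (\<lambda>s. fderiv (0, s *\<^sub>R axis m 1) f x y)) (at 0)"
    by simp
  moreover have "fderiv (0, s *\<^sub>R axis m 1) f x y = fderiv (0, axis m 1) f x y * s" for s
    using linear_cmul[OF has_derivative_linear[OF der], of s "(0, axis m 1)"] by simp
  ultimately show ?thesis
    by (auto simp: dy_def partial_def has_field_derivative_def intro!: DERIV_imp_deriv)
qed

text \<open>By linearity of the derivative, \<open>d_op\<close> differentiates along the horizontal
  lift of the coordinate vector \<open>axis m 1\<close>. Sum and product rules therefore follow
  pointwise, before anything is known about the regularity of \<open>conn\<close>.\<close>

lemma d_op_eq_fderiv:
  assumes "smooth_field U f" "x \<in> U" "y \<noteq> 0"
  shows "d_op a t m f x y = fderiv (axis m 1, \<chi> k. conn a t k m x y) f x y"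
  by (simp add: d_op_def fderiv_lincomb[OF assms] dx_eq_fderiv[OF assms] dy_eq_fderiv[OF assms])

lemma has_derivative_imp_fderiv:
  "((\<lambda>(x, y). f x y) has_derivative f') (at (x, y)) \<Longrightarrow> fderiv v f x y = f' v"
  using frechet_derivative_at by (metis fderiv_def)

lemma fderiv_const: "fderiv v (\<lambda>x y. c) x y = 0"
  by (rule has_derivative_imp_fderiv[of _ "\<lambda>_. 0"]) (simp add: case_prod_beta')

lemma fderiv_add:
  assumes "smooth_field U f" "smooth_field U g" "x \<in> U" "y \<noteq> 0"
  shows "fderiv v (\<lambda>x y. f x y + g x y) x y = fderiv v f x y + fderiv v g x y"
  by (rule has_derivative_imp_fderiv)
     (use has_derivative_add[OF has_derivative_fderiv[OF assms(1,3,4)] has_derivative_fderiv[OF assms(2,3,4)]]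
      in \<open>simp add: case_prod_beta'\<close>)

lemma fderiv_mult:
  assumes "smooth_field U f" "smooth_field U g" "x \<in> U" "y \<noteq> 0"
  shows "fderiv v (\<lambda>x y. f x y * g x y) x y = f x y * fderiv v g x y + fderiv v f x y * g x y"
  by (rule has_derivative_imp_fderiv)
     (use has_derivative_mult[OF has_derivative_fderiv[OF assms(1,3,4)] has_derivative_fderiv[OF assms(2,3,4)]]
      in \<open>simp add: case_prod_beta'\<close>)

lemma fderiv_sum:
  assumes "\<And>i. i \<in> I \<Longrightarrow> smooth_field U (f i)" "x \<in> U" "y \<noteq> 0"
  shows "fderiv v (\<lambda>x y. \<Sum>i\<in>I. f i x y) x y = (\<Sum>i\<in>I. fderiv v (f i) x y)"
  by (rule has_derivative_imp_fderiv)
     (use has_derivative_sum[OF has_derivative_fderiv[OF assms]] in \<open>simp add: case_prod_beta'\<close>)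

lemma fderiv_snd_component: "fderiv (0, axis m 1) (\<lambda>x y. y $ k) x y = (if m = k then 1 else 0)"
proof -
  have "((\<lambda>(x, y). y $ k) has_derivative (\<lambda>v. snd v $ k)) (at (x, y))"
    unfolding case_prod_beta'
    by (intro bounded_linear_imp_has_derivative
        bounded_linear_compose[OF bounded_linear_vec_nth bounded_linear_snd])
  from has_derivative_imp_fderiv[OF this, of "(0, axis m 1)"] show ?thesis
    by (simp add: axis_def eq_commute)
qed

context
  fixes U :: "(real^'n) set"
  assumes open_U: "open U"
begin

section \<open>Locality and closure properties of smooth fields\<close>

lemma open_slit: "open (U \<times> (- {0 :: real^'n}))"
  using open_U by (auto intro: open_Times)

lemma smooth_field_cong:
  assumes "\<And>x y. x \<in> U \<Longrightarrow> y \<noteq> 0 \<Longrightarrow> f x y = g x y" "smooth_field U f"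
  shows "smooth_field U g"
  unfolding smooth_field_def smooth_on_def
  by (intro allI Ck_on_cong[OF open_slit _ smooth_fieldD[OF assms(2)]]) (auto intro: assms(1))

lemma fderiv_cong:
  assumes "\<And>x y. x \<in> U \<Longrightarrow> y \<noteq> 0 \<Longrightarrow> f x y = g x y" "smooth_field U f" "x \<in> U" "y \<noteq> 0"
  shows "fderiv v f x y = fderiv v g x y"
proof -
  have "((\<lambda>(x, y). g x y) has_derivative (\<lambda>v. fderiv v f x y)) (at (x, y))"
    using has_derivative_transform_within_open[OF has_derivative_fderiv[OF assms(2-4)] open_slit,
        of "\<lambda>(x, y). g x y"] assms
    by auto
  from has_derivative_imp_fderiv[OF this, of v] show ?thesis by simp
qed

lemma fderiv_commute:
  assumes "smooth_field U f" "x \<in> U" "y \<noteq> 0"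
  shows "fderiv v (fderiv w f) x y = fderiv w (fderiv v f) x y"
  using frechet_derivative_commute[OF open_slit smooth_fieldD[OF assms(1)], of "(x, y)" w v] assms(2,3)
  by (simp add: fderiv_def case_prod_beta')

lemma smooth_field_dx: "smooth_field U f \<Longrightarrow> smooth_field U (dx m f)"
  by (rule smooth_field_cong[OF _ smooth_field_fderiv]) (simp_all add: dx_eq_fderiv)

lemma smooth_field_dy: "smooth_field U f \<Longrightarrow> smooth_field U (dy m f)"
  by (rule smooth_field_cong[OF _ smooth_field_fderiv]) (simp_all add: dy_eq_fderiv)

lemma smooth_field_const: "smooth_field U (\<lambda>x y. c)"
  by (simp add: smooth_field_def smooth_on_def case_prod_beta' Ck_on_const[OF open_slit])

lemma smooth_field_add:
  "smooth_field U f \<Longrightarrow> smooth_field U g \<Longrightarrow> smooth_field U (\<lambda>x y. f x y + g x y)"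
  by (simp add: smooth_field_def smooth_on_def case_prod_beta' Ck_on_add[OF open_slit])

lemma smooth_field_mult:
  "smooth_field U f \<Longrightarrow> smooth_field U g \<Longrightarrow> smooth_field U (\<lambda>x y. f x y * g x y)"
  by (simp add: smooth_field_def smooth_on_def case_prod_beta' Ck_on_mult[OF open_slit])

lemma smooth_field_uminus: "smooth_field U f \<Longrightarrow> smooth_field U (\<lambda>x y. - f x y)"
  using smooth_field_mult[OF smooth_field_const[of "- 1"]] by simp

lemma smooth_field_diff:
  "smooth_field U f \<Longrightarrow> smooth_field U g \<Longrightarrow> smooth_field U (\<lambda>x y. f x y - g x y)"
  using smooth_field_add[OF _ smooth_field_uminus] by simp

lemma smooth_field_inverse:
  "smooth_field U f \<Longrightarrow> (\<And>x y. x \<in> U \<Longrightarrow> y \<noteq> 0 \<Longrightarrow> f x y \<noteq> 0) \<Longrightarrow>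
    smooth_field U (\<lambda>x y. inverse (f x y))"
  by (auto simp: smooth_field_def smooth_on_def case_prod_beta' intro!: Ck_on_inverse[OF open_slit])

lemma smooth_field_divide:
  "smooth_field U f \<Longrightarrow> smooth_field U g \<Longrightarrow> (\<And>x y. x \<in> U \<Longrightarrow> y \<noteq> 0 \<Longrightarrow> g x y \<noteq> 0) \<Longrightarrow>
    smooth_field U (\<lambda>x y. f x y / g x y)"
  by (simp add: divide_inverse smooth_field_mult smooth_field_inverse)

lemma smooth_field_sum:
  "(\<And>i. i \<in> I \<Longrightarrow> smooth_field U (f i)) \<Longrightarrow> smooth_field U (\<lambda>x y. \<Sum>i\<in>I. f i x y)"
  by (induction I rule: infinite_finite_induct) (simp_all add: smooth_field_const smooth_field_add)

lemma smooth_field_prod: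
  "(\<And>i. i \<in> I \<Longrightarrow> smooth_field U (f i)) \<Longrightarrow> smooth_field U (\<lambda>x y. \<Prod>i\<in>I. f i x y)"
  by (induction I rule: infinite_finite_induct) (simp_all add: smooth_field_const smooth_field_mult)

lemma smooth_field_base:
  assumes "smooth_on f U"
  shows "smooth_field U (\<lambda>x y. f x)"
  using assms by (auto simp: smooth_field_def smooth_on_def case_prod_beta' intro!: Ck_on_compose_linear[OF open_slit bounded_linear_fst, of U])

lemma smooth_field_snd_component: "smooth_field U (\<lambda>x y. y $ k)"
proof -
  have "Ck_on i (\<lambda>z::(real^'n) \<times> (real^'n). z) (U \<times> (- {0}))" for i
  proof (cases i)
    case 0 then show ?thesis by simp
  next
    case (Suc i)
    then show ?thesis
      using Ck_on_SucI[OF open_slit has_derivative_ident Ck_on_const[OF open_slit]] by simp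
  qed
  from Ck_on_linear_compose[OF open_slit
      bounded_linear_compose[OF bounded_linear_vec_nth[of k] bounded_linear_snd] this]
  show ?thesis by (simp add: smooth_field_def smooth_on_def case_prod_beta')
qed

lemma smooth_field_component:
  assumes "smooth_on (\<lambda>(x, y). f x y) (U \<times> (- {0}))"
  shows "smooth_field U (\<lambda>x y. f x y $ i)"
  using assms by (auto simp: smooth_field_def smooth_on_def case_prod_beta' intro!: Ck_on_linear_compose[OF open_slit bounded_linear_vec_nth[of i]])

lemma smooth_on_base_component:
  assumes "smooth_on f U"
  shows "smooth_on (\<lambda>x. f x $ i) U"
  using assms by (auto simp: smooth_on_def intro!: Ck_on_linear_compose[OF open_U bounded_linear_vec_nth[of i]])

section \<open>Determinants and inverse matrices of smooth fields\<close>

lemma smooth_field_det: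
  fixes A :: "real^'n \<Rightarrow> real^'n \<Rightarrow> real^'m^'m"
  assumes "\<And>i j. smooth_field U (\<lambda>x y. A x y $ i $ j)"
  shows "smooth_field U (\<lambda>x y. det (A x y))"
  unfolding det_def
  by (intro smooth_field_sum smooth_field_mult smooth_field_const smooth_field_prod assms)

text \<open>Cramer's rule: column \<open>l\<close> of the inverse solves the linear system with
  right-hand side \<open>axis l 1\<close>, so each entry is a quotient of determinants, which are
  polynomial in the matrix entries.\<close>

lemma smooth_field_matrix_inv:
  fixes A :: "real^'n \<Rightarrow> real^'n \<Rightarrow> real^'m^'m"
  assumes smooth: "\<And>i j. smooth_field U (\<lambda>x y. A x y $ i $ j)"
    and inv: "\<And>x y. x \<in> U \<Longrightarrow> y \<noteq> 0 \<Longrightarrow> invertible (A x y)"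
  shows "smooth_field U (\<lambda>x y. matrix_inv (A x y) $ k $ l)"
proof (rule smooth_field_cong)
  let ?M = "\<lambda>x y. \<chi> i j. if j = k then axis l 1 $ i else A x y $ i $ j"
  show "det (?M x y) / det (A x y) = matrix_inv (A x y) $ k $ l" if "x \<in> U" "y \<noteq> 0" for x y
  proof -
    have "A x y ** matrix_inv (A x y) = mat 1"
      using inv[OF that] unfolding invertible_def matrix_inv_def by (metis (mono_tags, lifting) someI_ex)
    then have "A x y *v (matrix_inv (A x y) *v axis l 1) = axis l 1"
      by (simp add: matrix_vector_mul_assoc)
    moreover have "det (A x y) \<noteq> 0"
      using inv[OF that] by (simp add: invertible_det_nz)
    ultimately have "matrix_inv (A x y) *v axis l 1 = (\<chi> k. det (\<chi> i j. if j = k then axis l 1 $ i else A x y $ i $ j) / det (A x y))"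
      by (simp add: cramer)
    moreover have "(matrix_inv (A x y) *v axis l 1) $ k = matrix_inv (A x y) $ k $ l"
      by (simp add: matrix_vector_mult_basis column_def)
    ultimately show ?thesis by simp
  qed
  have "smooth_field U (\<lambda>x y. ?M x y $ i $ j)" for i j
    by (cases "j = k") (simp_all add: smooth smooth_field_const)
  then show "smooth_field U (\<lambda>x y. det (?M x y) / det (A x y))"
    using inv by (intro smooth_field_divide smooth_field_det smooth) (simp_all add: invertible_det_nz)
qed

end

section \<open>Linear algebra and calculus of fields\<close>

text \<open>A positive definite matrix is injective. In component form this cancels a contracted
  metric: it gives the invertibility of the Jacobian and, at the very end, removes the lowered
  index.\<close>

lemma pos_def_kernel:
  assumes "pos_def A" "\<And>l. (\<Sum>k\<in>UNIV. A $ l $ k * w k) = 0"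
  shows "w k = 0"
proof -
  have "A *v (\<chi> k. w k) = 0"
    using assms(2) by (simp add: matrix_vector_mult_def vec_eq_iff)
  then have "(\<chi> k. w k) = 0"
    using assms(1) unfolding pos_def_def by (metis inner_zero_right less_irrefl)
  then show ?thesis by (simp add: vec_eq_iff)
qed

lemma invertible_if_kernel_trivial:
  fixes A :: "real^'n^'n"
  assumes "\<And>v. A *v v = 0 \<Longrightarrow> v = 0"
  shows "invertible A"
  using assms matrix_left_invertible_ker[of A] invertible_left_inverse by blast

lemma pos_def_invertible: "pos_def A \<Longrightarrow> invertible A"
  by (rule invertible_if_kernel_trivial) (metis pos_def_def inner_zero_right less_irrefl)

lemma matrix_inv_inverse:
  assumes "invertible A"
  shows "A ** matrix_inv A = mat 1" "matrix_inv A ** A = mat 1"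
  using someI_ex[OF assms[unfolded invertible_def]] by (simp_all add: matrix_inv_def)

lemma sum_matrix_inv:
  fixes A :: "real^'n^'n"
  assumes "invertible A"
  shows "(\<Sum>k\<in>UNIV. A $ i $ k * matrix_inv A $ k $ j) = (if i = j then 1 else 0)"
  using arg_cong[OF matrix_inv_inverse(1)[OF assms], of "\<lambda>M. M $ i $ j"]
  by (simp add: matrix_matrix_mult_def mat_def)

lemma fderiv_zero_left:
  fixes f :: "real^'n \<Rightarrow> real^'n \<Rightarrow> real"
  assumes "smooth_field U f" "x \<in> U" "y \<noteq> 0"
  shows "fderiv (0, v) f x y = (\<Sum>k\<in>UNIV. v $ k * fderiv (0, axis k 1) f x y)"
proof -
  \<comment> \<open>\<open>fderiv_lincomb\<close> always carries a base direction; one is added for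
    an arbitrary \<open>m\<close> and subtracted again.\<close>
  have "(axis m 1, \<chi> k. v $ k) = (axis m 1, 0) + (0 :: real^'n, v)" for m :: 'n
    by simp
  then have "fderiv (axis m 1, \<chi> k. v $ k) f x y = fderiv (axis m 1, 0) f x y + fderiv (0, v) f x y" for m
    by (simp only: linear_add[OF has_derivative_linear[OF has_derivative_fderiv[OF assms]]])
  from this[of undefined] show ?thesis
    using fderiv_lincomb[OF assms, of undefined "\<lambda>k. v $ k"] by linarith
qed

text \<open>The algebra behind metric compatibility: the connection terms in \<open>db\<close>
  cancel those in \<open>du\<close> and \<open>dw\<close>, so that only the remainders
  \<open>r\<close> and \<open>s\<close> survive. It is applied with \<open>b\<close> the Riemannian
  metric and \<open>c\<close> its Christoffel symbols.\<close>

lemma bilinear_parallel: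
  fixes b c :: "'n::finite \<Rightarrow> 'n \<Rightarrow> real"
  assumes sym: "\<And>i l. b i l = b l i"
    and db: "\<And>i l. db i l = (\<Sum>h\<in>UNIV. b l h * c h i) + (\<Sum>h\<in>UNIV. b i h * c h l)"
    and du: "\<And>i. du i = r i - (\<Sum>h\<in>UNIV. c i h * u h)"
    and dw: "\<And>l. dw l = s l - (\<Sum>h\<in>UNIV. c l h * w h)"
  shows "(\<Sum>i\<in>UNIV. \<Sum>l\<in>UNIV. db i l * u i * w l + b i l * du i * w l + b i l * u i * dw l) =
    (\<Sum>i\<in>UNIV. \<Sum>l\<in>UNIV. b i l * r i * w l) + (\<Sum>i\<in>UNIV. \<Sum>l\<in>UNIV. b i l * u i * s l)"
proof -
  \<comment> \<open>Renaming summation indices moves the connection from \<open>b\<close> onto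
    \<open>u\<close>; the symmetry of \<open>b\<close> restores the index order.\<close>
  have 1: "(\<Sum>i\<in>UNIV. \<Sum>l\<in>UNIV. (\<Sum>h\<in>UNIV. b l h * c h i) * u i * w l) =
      (\<Sum>i\<in>UNIV. \<Sum>l\<in>UNIV. b i l * (\<Sum>h\<in>UNIV. c i h * u h) * w l)" (is "?L = ?R")
  proof -
    have "?L = (\<Sum>i\<in>UNIV. \<Sum>l\<in>UNIV. \<Sum>h\<in>UNIV. b l h * c h i * u i * w l)"
      by (simp add: sum_distrib_right)
    also have "\<dots> = (\<Sum>l\<in>UNIV. \<Sum>i\<in>UNIV. \<Sum>h\<in>UNIV. b l h * c h i * u i * w l)"
      by (rule sum.swap)
    also have "\<dots> = (\<Sum>l\<in>UNIV. \<Sum>h\<in>UNIV. \<Sum>i\<in>UNIV. b l h * c h i * u i * w l)"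
      by (intro sum.cong refl sum.swap)
    also have "\<dots> = (\<Sum>h\<in>UNIV. \<Sum>l\<in>UNIV. \<Sum>i\<in>UNIV. b l h * c h i * u i * w l)"
      by (rule sum.swap)
    also have "\<dots> = ?R"
      by (simp add: sum_distrib_left sum_distrib_right sym ac_simps)
    finally show ?thesis .
  qed
  have 2: "(\<Sum>i\<in>UNIV. \<Sum>l\<in>UNIV. (\<Sum>h\<in>UNIV. b i h * c h l) * u i * w l) =
      (\<Sum>i\<in>UNIV. \<Sum>l\<in>UNIV. b i l * u i * (\<Sum>h\<in>UNIV. c l h * w h))" (is "?L = ?R")
  proof -
    have "?L = (\<Sum>i\<in>UNIV. \<Sum>l\<in>UNIV. \<Sum>h\<in>UNIV. b i h * c h l * u i * w l)"
      by (simp add: sum_distrib_right)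
    also have "\<dots> = (\<Sum>i\<in>UNIV. \<Sum>h\<in>UNIV. \<Sum>l\<in>UNIV. b i h * c h l * u i * w l)"
      by (intro sum.cong refl sum.swap)
    also have "\<dots> = ?R"
      by (simp add: sum_distrib_left ac_simps)
    finally show ?thesis .
  qed
  show ?thesis
    unfolding db du dw
    by (simp add: distrib_left distrib_right right_diff_distrib left_diff_distrib sum.distrib sum_subtractf 1 2)
qed

lemma d_op_base: "d_op a t m (\<lambda>x y. f x) x y = partial m f x"
  by (simp add: d_op_def dx_def dy_def partial_def)

lemma christoffel_lower:
  assumes "invertible (a x)"
  shows "(\<Sum>l\<in>UNIV. a x $ j $ l * christoffel a l i m x) =
    1/2 * (partial i (\<lambda>z. a z $ j $ m) x + partial m (\<lambda>z. a z $ j $ i) x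
      - partial j (\<lambda>z. a z $ i $ m) x)"
proof -
  define P where "P h = partial i (\<lambda>z. a z $ h $ m) x + partial m (\<lambda>z. a z $ h $ i) x
      - partial h (\<lambda>z. a z $ i $ m) x" for h
  have "(\<Sum>l\<in>UNIV. a x $ j $ l * christoffel a l i m x) =
      1/2 * (\<Sum>l\<in>UNIV. \<Sum>h\<in>UNIV. a x $ j $ l * matrix_inv (a x) $ l $ h * P h)"
    by (simp add: christoffel_def P_def sum_distrib_left mult.left_commute mult.assoc)
  also have "(\<Sum>l\<in>UNIV. \<Sum>h\<in>UNIV. a x $ j $ l * matrix_inv (a x) $ l $ h * P h) =
      (\<Sum>h\<in>UNIV. (\<Sum>l\<in>UNIV. a x $ j $ l * matrix_inv (a x) $ l $ h) * P h)"
    by (subst sum.swap) (simp add: sum_distrib_right)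
  also have "\<dots> = P j"
    by (simp add: sum_matrix_inv[OF assms] if_distrib[of "\<lambda>u. u * _"] cong: if_cong)
  finally show ?thesis by (simp add: P_def)
qed

context
  fixes U :: "(real^'n) set"
  assumes open_U: "open U"
begin

lemmas smooth_field_intros =
  smooth_field_const[OF open_U] smooth_field_add[OF open_U] smooth_field_mult[OF open_U]
  smooth_field_uminus[OF open_U] smooth_field_diff[OF open_U] smooth_field_sum[OF open_U]
  smooth_field_divide[OF open_U] smooth_field_dx[OF open_U] smooth_field_dy[OF open_U]
  smooth_field_snd_component[OF open_U]

section \<open>Rules for vertical and horizontal derivatives\<close>

lemma dy_cong:
  assumes "\<And>x y. x \<in> U \<Longrightarrow> y \<noteq> 0 \<Longrightarrow> f x y = g x y" "smooth_field U f" "x \<in> U" "y \<noteq> 0"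
  shows "dy m f x y = dy m g x y"
  using fderiv_cong[OF open_U assms] smooth_field_cong[OF open_U assms(1,2)] assms(2-4)
  by (simp add: dy_eq_fderiv)

lemma d_op_cong:
  assumes "\<And>x y. x \<in> U \<Longrightarrow> y \<noteq> 0 \<Longrightarrow> f x y = g x y" "smooth_field U f" "x \<in> U" "y \<noteq> 0"
  shows "d_op a t m f x y = d_op a t m g x y"
  using fderiv_cong[OF open_U assms] smooth_field_cong[OF open_U assms(1,2)] assms(2-4)
  by (simp add: d_op_eq_fderiv)

lemma dy_mult:
  assumes "smooth_field U f" "smooth_field U g" "x \<in> U" "y \<noteq> 0"
  shows "dy m (\<lambda>x y. f x y * g x y) x y = f x y * dy m g x y + dy m f x y * g x y"
  using assms smooth_field_mult[OF open_U assms(1,2)] by (simp add: dy_eq_fderiv fderiv_mult)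

lemma d_op_mult:
  assumes "smooth_field U f" "smooth_field U g" "x \<in> U" "y \<noteq> 0"
  shows "d_op a t m (\<lambda>x y. f x y * g x y) x y = f x y * d_op a t m g x y + d_op a t m f x y * g x y"
  using assms smooth_field_mult[OF open_U assms(1,2)] by (simp add: d_op_eq_fderiv fderiv_mult)

lemma dy_sum:
  assumes "\<And>i. i \<in> I \<Longrightarrow> smooth_field U (f i)" "x \<in> U" "y \<noteq> 0"
  shows "dy m (\<lambda>x y. \<Sum>i\<in>I. f i x y) x y = (\<Sum>i\<in>I. dy m (f i) x y)"
  using assms smooth_field_sum[OF open_U, of I f] by (simp add: dy_eq_fderiv[where U = U] fderiv_sum[where U = U] cong: sum.cong)

lemma d_op_sum:
  assumes "\<And>i. i \<in> I \<Longrightarrow> smooth_field U (f i)" "x \<in> U" "y \<noteq> 0"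
  shows "d_op a t m (\<lambda>x y. \<Sum>i\<in>I. f i x y) x y = (\<Sum>i\<in>I. d_op a t m (f i) x y)"
  using assms smooth_field_sum[OF open_U, of I f] by (simp add: d_op_eq_fderiv[where U = U] fderiv_sum[where U = U] cong: sum.cong)

lemma dy_add:
  assumes "smooth_field U f" "smooth_field U g" "x \<in> U" "y \<noteq> 0"
  shows "dy m (\<lambda>x y. f x y + g x y) x y = dy m f x y + dy m g x y"
  using assms smooth_field_add[OF open_U assms(1,2)] by (simp add: dy_eq_fderiv fderiv_add)

lemma dy_cmult:
  assumes "smooth_field U f" "x \<in> U" "y \<noteq> 0"
  shows "dy m (\<lambda>x y. c * f x y) x y = c * dy m f x y"
  using dy_mult[OF smooth_field_const[OF open_U, of c] assms(1-3)] assms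
  by (simp add: dy_def partial_def)

lemma dy_uminus:
  assumes "smooth_field U f" "x \<in> U" "y \<noteq> 0"
  shows "dy m (\<lambda>x y. - f x y) x y = - dy m f x y"
  using dy_cmult[OF assms, of m "- 1"] by simp

lemma d_op_cmult:
  assumes "smooth_field U f" "x \<in> U" "y \<noteq> 0"
  shows "d_op a t m (\<lambda>x y. c * f x y) x y = c * d_op a t m f x y"
  using d_op_mult[OF smooth_field_const[OF open_U, of c] assms(1-3)] assms
  by (simp add: d_op_eq_fderiv[OF smooth_field_const[OF open_U]] fderiv_const)

lemma dy_commute:
  assumes "smooth_field U f" "x \<in> U" "y \<noteq> 0"
  shows "dy m (dy n f) x y = dy n (dy m f) x y"
proof -
  \<comment> \<open>\<open>dy\<close> agrees with \<open>fderiv\<close> only over the slit bundle,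
    so the inner derivative is exchanged by locality.\<close>
  have "dy m (dy n f) x y = fderiv (0, axis m 1) (fderiv (0, axis n 1) f) x y" for m n
    using fderiv_cong[OF open_U dy_eq_fderiv[OF assms(1), of _ _ n] smooth_field_dy[OF open_U assms(1)] assms(2,3)]
      dy_eq_fderiv[OF smooth_field_dy[OF open_U assms(1)] assms(2,3)] by simp
  then show ?thesis using fderiv_commute[OF open_U assms] by simp
qed

lemma dx_dy_commute:
  assumes "smooth_field U f" "x \<in> U" "y \<noteq> 0"
  shows "dx m (dy n f) x y = dy n (dx m f) x y"
proof -
  have "dx m (dy n f) x y = fderiv (axis m 1, 0) (fderiv (0, axis n 1) f) x y"
    using fderiv_cong[OF open_U dy_eq_fderiv[OF assms(1), of _ _ n] smooth_field_dy[OF open_U assms(1)] assms(2,3)]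
      dx_eq_fderiv[OF smooth_field_dy[OF open_U assms(1)] assms(2,3)] by simp
  moreover have "dy n (dx m f) x y = fderiv (0, axis n 1) (fderiv (axis m 1, 0) f) x y"
    using fderiv_cong[OF open_U dx_eq_fderiv[OF assms(1), of _ _ m] smooth_field_dx[OF open_U assms(1)] assms(2,3)]
      dy_eq_fderiv[OF smooth_field_dx[OF open_U assms(1)] assms(2,3)] by simp
  ultimately show ?thesis using fderiv_commute[OF open_U assms] by simp
qed

lemma smooth_field_d_op:
  assumes "\<And>k. smooth_field U (conn a t k m)" "smooth_field U f"
  shows "smooth_field U (d_op a t m f)"
proof -
  have "smooth_field U (\<lambda>x y. dx m f x y + (\<Sum>k\<in>UNIV. conn a t k m x y * dy k f x y))"
    by (intro smooth_field_intros assms)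
  moreover have "d_op a t m f = (\<lambda>x y. dx m f x y + (\<Sum>k\<in>UNIV. conn a t k m x y * dy k f x y))"
    by (simp add: d_op_def fun_eq_iff)
  ultimately show ?thesis by simp
qed

text \<open>Coordinate derivatives commute, so the only excess comes from differentiating the
  coefficients \<open>conn\<close> in \<open>y\<close>.\<close>

lemma dy_d_op:
  assumes N: "\<And>k. smooth_field U (conn a t k m)" and f: "smooth_field U f" and "x \<in> U" "y \<noteq> 0"
  shows "dy n (d_op a t m f) x y =
    d_op a t m (dy n f) x y + (\<Sum>k\<in>UNIV. conn2 a t k m n x y * dy k f x y)"
proof -
  have "d_op a t m f = (\<lambda>x y. dx m f x y + (\<Sum>k\<in>UNIV. conn a t k m x y * dy k f x y))"
    by (simp add: d_op_def fun_eq_iff)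
  then have "dy n (d_op a t m f) x y = dy n (dx m f) x y +
      (\<Sum>k\<in>UNIV. conn a t k m x y * dy n (dy k f) x y + dy n (conn a t k m) x y * dy k f x y)"
    using assms by (simp add: dy_add dy_sum dy_mult smooth_field_intros)
  then show ?thesis
    by (simp add: d_op_def conn2_def dx_dy_commute[OF assms(2-4)] dy_commute[OF assms(2-4), of n] sum.distrib)
qed

text \<open>Euler's theorem for a field whose scaling behaviour \<open>c\<close> need only be known up to first order.\<close>

lemma euler_field:
  assumes f: "smooth_field U f" "x \<in> U" "y \<noteq> 0"
    and hom: "\<And>k. k > 0 \<Longrightarrow> f x (k *\<^sub>R y) = c k * f x y"
    and c: "(c has_field_derivative r) (at 1)"
  shows "(\<Sum>m\<in>UNIV. y $ m * dy m f x y) = r * f x y"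
proof -
  note der = has_derivative_fderiv[OF f]
  have "((\<lambda>s. (x, s *\<^sub>R y)) has_derivative (\<lambda>s. (0, s *\<^sub>R y))) (at 1)"
    by (auto intro!: derivative_eq_intros)
  from has_derivative_compose[OF this, of "\<lambda>(x, y). f x y" "\<lambda>v. fderiv v f x y"] der
  have "((\<lambda>s. f x (s *\<^sub>R y)) has_derivative (\<lambda>s. fderiv (0, s *\<^sub>R y) f x y)) (at 1)"
    by simp
  moreover have "fderiv (0, s *\<^sub>R y) f x y = fderiv (0, y) f x y * s" for s
    using linear_cmul[OF has_derivative_linear[OF der], of s "(0, y)"] by simp
  ultimately have "((\<lambda>s. f x (s *\<^sub>R y)) has_field_derivative fderiv (0, y) f x y) (at 1)"
    by (simp add: has_field_derivative_def)
  \<comment> \<open>The scaling law is given for positive factors only; these form an open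
    neighbourhood of 1.\<close>
  moreover have "((\<lambda>s. f x (s *\<^sub>R y)) has_field_derivative r * f x y) (at 1)"
    by (rule has_field_derivative_transform_within_open[where S = "{0<..}"])
       (use DERIV_cmult_right[OF c, of "f x y"] hom in auto)
  ultimately have "fderiv (0, y) f x y = r * f x y"
    by (rule DERIV_unique)
  then show ?thesis
    using fderiv_zero_left[OF f, of y] by (simp add: dy_eq_fderiv[OF f])
qed

lemma partial_base_cong:
  assumes "smooth_on f U" "\<And>x. x \<in> U \<Longrightarrow> f x = g x" "x \<in> U"
  shows "partial m f x = partial m g x"
proof -
  obtain m0 :: 'n where True by simp
  \<comment> \<open>Any nonzero fibre vector will do: it lets functions on the base be treated as
    fields on the slit bundle, where \<open>fderiv_cong\<close> supplies locality.\<close>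
  have nz: "axis m0 1 \<noteq> (0 :: real^'n)" by (simp add: axis_eq_0_iff)
  have "dx m (\<lambda>x y. f x) x (axis m0 1) = dx m (\<lambda>x y. g x) x (axis m0 1)"
    using fderiv_cong[OF open_U _ smooth_field_base[OF open_U assms(1)] assms(3) nz, of "\<lambda>x y. g x"]
      smooth_field_cong[OF open_U _ smooth_field_base[OF open_U assms(1)], of "\<lambda>x y. g x"]
      smooth_field_base[OF open_U assms(1)] assms(2,3) nz
    by (simp add: dx_eq_fderiv)
  then show ?thesis by (simp add: dx_def)
qed

text \<open>In the sum of the two lowered Christoffel symbols the derivatives of \<open>a\<close> in
  the directions \<open>i\<close> and \<open>j\<close> cancel by symmetry. The symmetry holds on
  \<open>U\<close> only and passes to derivatives by locality.\<close>

lemma metric_compatible: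
  assumes a: "riemannian_metric U a" and x: "x \<in> U"
  shows "partial m (\<lambda>z. a z $ i $ j) x =
    (\<Sum>l\<in>UNIV. a x $ j $ l * christoffel a l i m x) + (\<Sum>l\<in>UNIV. a x $ i $ l * christoffel a l j m x)"
proof -
  have inv: "invertible (a x)"
    using a x pos_def_invertible by (auto simp: riemannian_metric_def)
  have sym: "a z $ k $ l = a z $ l $ k" if "z \<in> U" for z k l
    using a that by (auto simp: riemannian_metric_def transpose_def vec_eq_iff)
  have "smooth_on (\<lambda>z. a z $ k $ l) U" for k l
    using a by (auto simp: riemannian_metric_def intro!: smooth_on_base_component[OF open_U])
  then have "partial h (\<lambda>z. a z $ k $ l) x = partial h (\<lambda>z. a z $ l $ k) x" for h k l
    by (rule partial_base_cong) (auto simp: sym x)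
  then show ?thesis
    unfolding christoffel_lower[of a x, OF inv] by (simp add: field_simps)
qed

end

section \<open>Conformal automorphisms and their connection\<close>

context
  fixes U :: "(real^'n) set"
    and F :: "real^'n \<Rightarrow> real^'n \<Rightarrow> real"
    and a :: "real^'n \<Rightarrow> real^'n^'n"
    and H :: "real^'n \<Rightarrow> real"
    and t :: "real^'n \<Rightarrow> real^'n \<Rightarrow> real^'n"
  assumes open_U: "open U"
    and finsler: "finsler_metric U F"
    and riem: "riemannian_metric U a"
    and conf: "conformally_automorphic_via U F a H t"
begin

lemmas smooth_intros = smooth_field_intros[OF open_U]

abbreviation g where "g i j x y \<equiv> metric_tensor F x y $ i $ j"
abbreviation T where "T i m \<equiv> dy m (\<lambda>x y. t x y $ i)"

section \<open>Regularity and symmetry of the given fields\<close>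

lemma smooth_F: "smooth_field U F"
  using finsler by (simp add: finsler_metric_def smooth_field_def)

lemma smooth_F2: "smooth_field U (\<lambda>x y. (F x y)\<^sup>2)"
  unfolding power2_eq_square by (intro smooth_intros smooth_F)

lemma smooth_g: "smooth_field U (g i j)"
  unfolding metric_tensor_def by (simp, intro smooth_intros smooth_F2) simp

lemma smooth_t: "smooth_field U (\<lambda>x y. t x y $ i)"
  using conf by (intro smooth_field_component[OF open_U]) (simp add: conformally_automorphic_via_def)

lemma smooth_T: "smooth_field U (T i m)"
  by (intro smooth_intros smooth_t)

lemma smooth_a: "smooth_field U (\<lambda>x y. a x $ i $ j)"
  using riem
  by (intro smooth_field_base[OF open_U] smooth_on_base_component[OF open_U])
    (simp add: riemannian_metric_def)

lemma a_sym: "x \<in> U \<Longrightarrow> a x $ i $ j = a x $ j $ i"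
  using riem by (auto simp: riemannian_metric_def transpose_def vec_eq_iff)

lemma g_sym:
  assumes "x \<in> U" "y \<noteq> 0"
  shows "g i j x y = g j i x y"
  using dy_commute[OF open_U smooth_F2 assms] by (simp add: metric_tensor_def)

lemma pos_def_g: "x \<in> U \<Longrightarrow> y \<noteq> 0 \<Longrightarrow> pos_def (metric_tensor F x y)"
  using finsler by (simp add: finsler_metric_def)

lemma t_nonzero: "x \<in> U \<Longrightarrow> y \<noteq> 0 \<Longrightarrow> t x y \<noteq> 0"
  using conf by (auto simp: conformally_automorphic_via_def bij_betw_def)

text \<open>Only the value of \<open>p\<close> at one point is extracted. The definition states no
  regularity of \<open>p\<close>; that comes later, from the explicit formula in
  \<open>g_eq\<close>.\<close>

lemma conformal_factor:
  assumes "x \<in> U" "y \<noteq> 0"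
  obtains p where "p > 0"
    "\<And>m n. g m n x y = p\<^sup>2 * (\<Sum>i\<in>UNIV. \<Sum>j\<in>UNIV. a x $ i $ j * T i m x y * T j n x y)"
proof -
  have "\<exists>p. \<forall>x\<in>U. \<forall>y. y \<noteq> 0 \<longrightarrow> 0 < p x y \<and>
      (\<forall>m n. g m n x y = (p x y)\<^sup>2 * (\<Sum>i\<in>UNIV. \<Sum>j\<in>UNIV. a x $ i $ j * T i m x y * T j n x y))"
    using conf unfolding conformally_automorphic_via_def by (elim conjE)
  then obtain p where "\<forall>x\<in>U. \<forall>y. y \<noteq> 0 \<longrightarrow> 0 < p x y \<and>
      (\<forall>m n. g m n x y = (p x y)\<^sup>2 * (\<Sum>i\<in>UNIV. \<Sum>j\<in>UNIV. a x $ i $ j * T i m x y * T j n x y))" ..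
  then show thesis
    using assms that[of "p x y"] by simp
qed

section \<open>The Jacobian of the transformation and its inverse\<close>

definition jac :: "real^'n \<Rightarrow> real^'n \<Rightarrow> real^'n^'n" where
  "jac x y = (\<chi> i m. T i m x y)"

text \<open>By conformality a null vector of the Jacobian is also a null vector of \<open>g\<close>,
  which is positive definite.\<close>

lemma invertible_jac:
  assumes "x \<in> U" "y \<noteq> 0"
  shows "invertible (jac x y)"
proof (rule invertible_if_kernel_trivial)
  fix v assume v: "jac x y *v v = 0"
  obtain p where "p > 0"
    and p: "\<And>m n. g m n x y = p\<^sup>2 * (\<Sum>i\<in>UNIV. \<Sum>j\<in>UNIV. a x $ i $ j * T i m x y * T j n x y)"
    by (rule conformal_factor[OF assms]) (rule that)
  have Tv: "(\<Sum>n\<in>UNIV. T j n x y * v $ n) = 0" for j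
    using arg_cong[OF v, of "\<lambda>w. w $ j"] by (simp add: matrix_vector_mult_def jac_def)
  have "(\<Sum>n\<in>UNIV. g m n x y * v $ n) = 0" for m
  proof -
    have "(\<Sum>n\<in>UNIV. g m n x y * v $ n) =
        (\<Sum>n\<in>UNIV. \<Sum>i\<in>UNIV. \<Sum>j\<in>UNIV. p\<^sup>2 * (a x $ i $ j * T i m x y) * (T j n x y * v $ n))"
      by (simp add: p sum_distrib_left sum_distrib_right mult.assoc)
    also have "\<dots> = (\<Sum>i\<in>UNIV. \<Sum>n\<in>UNIV. \<Sum>j\<in>UNIV. p\<^sup>2 * (a x $ i $ j * T i m x y) * (T j n x y * v $ n))"
      by (rule sum.swap)
    also have "\<dots> = (\<Sum>i\<in>UNIV. \<Sum>j\<in>UNIV. \<Sum>n\<in>UNIV. p\<^sup>2 * (a x $ i $ j * T i m x y) * (T j n x y * v $ n))"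
      by (intro sum.cong refl sum.swap)
    also have "\<dots> = 0"
      by (simp add: sum_distrib_left[symmetric] Tv)
    finally show ?thesis .
  qed
  then have "v $ k = 0" for k
    using pos_def_kernel[OF pos_def_g[OF assms], of "\<lambda>k. v $ k"] by blast
  then show "v = 0" by (simp add: vec_eq_iff)
qed

lemma has_derivative_t:
  assumes "x \<in> U" "y \<noteq> 0"
  shows "(t x has_derivative (*v) (jac x y)) (at y)"
proof -
  have "((\<lambda>y. t x y $ i) has_derivative (\<lambda>v. (jac x y *v v) $ i)) (at y)" for i
  proof -
    note der = has_derivative_fderiv[OF smooth_t assms]
    have "((\<lambda>y. (x, y)) has_derivative (\<lambda>v. (0, v))) (at y)"
      by (auto intro!: derivative_eq_intros)
    from has_derivative_compose[OF this, of "\<lambda>(x, y). t x y $ i" "\<lambda>v. fderiv v (\<lambda>x y. t x y $ i) x y"] der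
    have "((\<lambda>y. t x y $ i) has_derivative (\<lambda>v. fderiv (0, v) (\<lambda>x y. t x y $ i) x y)) (at y)"
      by simp
    moreover have "fderiv (0, v) (\<lambda>x y. t x y $ i) x y = (jac x y *v v) $ i" for v
      using fderiv_zero_left[OF smooth_t assms, of v]
      by (simp add: dy_eq_fderiv[OF smooth_t assms] matrix_vector_mult_def jac_def mult.commute)
    ultimately show ?thesis by simp
  qed
  then show ?thesis
    by (subst has_derivative_componentwise_within)
       (auto simp: Basis_vec_def inner_axis)
qed

text \<open>The inverse function theorem with \<open>inv_transf\<close> as inverse. It expresses
  \<open>conn\<close> through \<open>t\<close>, its derivatives, the Christoffel symbols and a
  matrix inverse, all of which are smooth.\<close>

lemma inv_jacobian_eq:
  assumes "x \<in> U" "y \<noteq> 0"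
  shows "inv_jacobian t k i x y = matrix_inv (jac x y) $ k $ i"
proof -
  note inv = matrix_inv_inverse[OF invertible_jac[OF assms]]
  have "inj_on (t x) (- {0})"
    using conf assms by (auto simp: conformally_automorphic_via_def bij_betw_def)
  then have left: "inv_transf t x (t x z) = z" if "z \<in> - {0}" for z
    using that by (simp add: inv_transf_def the_inv_into_f_f)
  have cont: "continuous_on (- {0}) (t x)"
    using has_derivative_t[OF assms(1)]
    by (intro continuous_at_imp_continuous_on ballI) (auto intro: has_derivative_continuous)
  have "(inv_transf t x has_derivative (*v) (matrix_inv (jac x y))) (at (t x y))"
    by (rule has_derivative_inverse_strong[OF _ _ cont left has_derivative_t[OF assms]])
       (use assms in \<open>auto simp: fun_eq_iff matrix_vector_mul_assoc inv\<close>)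
  from bounded_linear.has_derivative[OF bounded_linear_vec_nth[of k] this]
  have der: "((\<lambda>\<tau>. inv_transf t x \<tau> $ k) has_derivative (\<lambda>v. (matrix_inv (jac x y) *v v) $ k)) (at (t x y))" .
  have "((\<lambda>s. t x y + s *\<^sub>R axis i 1) has_derivative (\<lambda>s. s *\<^sub>R axis i 1)) (at 0)"
    by (auto intro!: derivative_eq_intros)
  from has_derivative_compose[OF this, of "\<lambda>\<tau>. inv_transf t x \<tau> $ k" "\<lambda>v. (matrix_inv (jac x y) *v v) $ k"] der
  have "((\<lambda>s. inv_transf t x (t x y + s *\<^sub>R axis i 1) $ k) has_derivative
      (\<lambda>s. (matrix_inv (jac x y) *v (s *\<^sub>R axis i 1)) $ k)) (at 0)"
    by simp
  moreover have "(matrix_inv (jac x y) *v (s *\<^sub>R axis i 1)) $ k = matrix_inv (jac x y) $ k $ i * s" for s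
    by (simp add: matrix_vector_mult_scaleR matrix_vector_mult_basis column_def)
  ultimately show ?thesis
    by (auto simp: inv_jacobian_def partial_def has_field_derivative_def intro!: DERIV_imp_deriv)
qed

lemma smooth_partial_a: "smooth_field U (\<lambda>x y. partial m (\<lambda>z. a z $ i $ j) x)"
  using smooth_field_dx[OF open_U smooth_a, of m i j] by (simp add: dx_def[abs_def])

lemma invertible_a: "x \<in> U \<Longrightarrow> invertible (a x)"
  using riem by (simp add: riemannian_metric_def pos_def_invertible)

lemma smooth_christoffel: "smooth_field U (\<lambda>x y. christoffel a i k n x)"
  unfolding christoffel_def
  by (intro smooth_intros smooth_partial_a smooth_field_matrix_inv[OF open_U, of "\<lambda>x y. a x"] smooth_a invertible_a)

lemma smooth_inv_jacobian: "smooth_field U (inv_jacobian t k i)"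
proof (rule smooth_field_cong[OF open_U])
  show "smooth_field U (\<lambda>x y. matrix_inv (jac x y) $ k $ i)"
    by (rule smooth_field_matrix_inv[OF open_U]) (simp_all add: invertible_jac, simp add: jac_def smooth_T)
qed (simp add: inv_jacobian_eq)

lemma smooth_conn: "smooth_field U (conn a t k m)"
proof -
  have "smooth_field U (\<lambda>x y. - (\<Sum>i\<in>UNIV. inv_jacobian t k i x y *
          (dx m (\<lambda>x y. t x y $ i) x y + (\<Sum>h\<in>UNIV. christoffel a i h m x * t x y $ h))))"
    by (intro smooth_intros smooth_inv_jacobian smooth_t smooth_christoffel)
  then show ?thesis
    by (simp add: conn_def[abs_def])
qed

lemma smooth_conn2: "smooth_field U (conn2 a t k m n)"
  unfolding conn2_def by (intro smooth_intros smooth_conn)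

text \<open>The connection is made so that \<open>t\<close> is parallel along the horizontal directions.\<close>

lemma d_op_t:
  assumes "x \<in> U" "y \<noteq> 0"
  shows "d_op a t m (\<lambda>x y. t x y $ i) x y = - (\<Sum>h\<in>UNIV. christoffel a i h m x * t x y $ h)"
proof -
  define R where "R l = dx m (\<lambda>x y. t x y $ l) x y + (\<Sum>h\<in>UNIV. christoffel a l h m x * t x y $ h)" for l
  have "conn a t k m x y = - (\<Sum>l\<in>UNIV. matrix_inv (jac x y) $ k $ l * R l)" for k
    by (simp add: conn_def R_def inv_jacobian_eq[OF assms])
  \<comment> \<open>The contraction with the Jacobian cancels its inverse and leaves
    \<open>- R i\<close>, whose first term cancels the \<open>dx\<close> part of
    \<open>d_op\<close>.\<close>
  then have "(\<Sum>k\<in>UNIV. conn a t k m x y * T i k x y) =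
      - (\<Sum>k\<in>UNIV. \<Sum>l\<in>UNIV. jac x y $ i $ k * matrix_inv (jac x y) $ k $ l * R l)"
    by (simp add: jac_def sum_distrib_left sum_negf ac_simps)
  also have "(\<Sum>k\<in>UNIV. \<Sum>l\<in>UNIV. jac x y $ i $ k * matrix_inv (jac x y) $ k $ l * R l) =
      (\<Sum>l\<in>UNIV. (\<Sum>k\<in>UNIV. jac x y $ i $ k * matrix_inv (jac x y) $ k $ l) * R l)"
    by (subst sum.swap) (simp add: sum_distrib_right)
  also have "\<dots> = R i"
    by (simp add: sum_matrix_inv[OF invertible_jac[OF assms]] if_distrib[of "\<lambda>u. u * _"] cong: if_cong)
  finally show ?thesis by (simp add: d_op_def R_def)
qed

text \<open>The \<open>y\<close>-derivative of \<open>d_op_t\<close>. The first sum is the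
  commutator term; the second says that otherwise each Jacobian column behaves like
  \<open>t\<close>, which is the form that \<open>d_op_bilinear\<close> expects.\<close>

lemma d_op_T:
  assumes "x \<in> U" "y \<noteq> 0"
  shows "d_op a t m (T i n) x y =
    - (\<Sum>k\<in>UNIV. conn2 a t k m n x y * T i k x y) - (\<Sum>h\<in>UNIV. christoffel a i h m x * T h n x y)"
proof -
  have "dy n (d_op a t m (\<lambda>x y. t x y $ i)) x y =
      dy n (\<lambda>x y. - (\<Sum>h\<in>UNIV. christoffel a i h m x * t x y $ h)) x y"
    by (rule dy_cong[OF open_U _ smooth_field_d_op[OF open_U smooth_conn smooth_t] assms])
       (simp add: d_op_t)
  also have "\<dots> = - (\<Sum>h\<in>UNIV. christoffel a i h m x * T h n x y)"
  proof -
    have "dy n (\<lambda>x y. christoffel a i h m x) x y = 0" for h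
      by (simp add: dy_def partial_def)
    then show ?thesis
      by (simp add: dy_uminus[OF open_U _ assms] dy_sum[OF open_U _ assms] dy_mult[OF open_U _ _ assms]
          smooth_intros smooth_christoffel smooth_t)
  qed
  finally show ?thesis
    using dy_d_op[OF open_U smooth_conn smooth_t[of i] assms, of n m] by simp
qed

text \<open>If \<open>u\<close> and \<open>w\<close> follow the Levi-Civita connection up to
  remainders, only the remainders affect their scalar product. For \<open>t\<close> the remainders
  vanish; for Jacobian columns they are the \<open>conn2\<close> terms.\<close>

lemma d_op_bilinear:
  assumes xy: "x \<in> U" "y \<noteq> 0"
    and u: "\<And>i. smooth_field U (u i)" and w: "\<And>i. smooth_field U (w i)"
    and du: "\<And>i. d_op a t m (u i) x y = r i - (\<Sum>h\<in>UNIV. christoffel a i h m x * u h x y)"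
    and dw: "\<And>i. d_op a t m (w i) x y = s i - (\<Sum>h\<in>UNIV. christoffel a i h m x * w h x y)"
  shows "d_op a t m (\<lambda>x y. \<Sum>i\<in>UNIV. \<Sum>l\<in>UNIV. a x $ i $ l * u i x y * w l x y) x y =
    (\<Sum>i\<in>UNIV. \<Sum>l\<in>UNIV. a x $ i $ l * r i * w l x y) + (\<Sum>i\<in>UNIV. \<Sum>l\<in>UNIV. a x $ i $ l * u i x y * s l)"
proof -
  have "d_op a t m (\<lambda>x y. \<Sum>i\<in>UNIV. \<Sum>l\<in>UNIV. a x $ i $ l * u i x y * w l x y) x y =
      (\<Sum>i\<in>UNIV. \<Sum>l\<in>UNIV. partial m (\<lambda>z. a z $ i $ l) x * u i x y * w l x y
        + a x $ i $ l * d_op a t m (u i) x y * w l x y + a x $ i $ l * u i x y * d_op a t m (w l) x y)"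
    by (simp add: d_op_sum[OF open_U _ xy] d_op_mult[OF open_U _ _ xy] d_op_base smooth_intros u w smooth_a
        distrib_right add_ac)
  also have "\<dots> = (\<Sum>i\<in>UNIV. \<Sum>l\<in>UNIV. a x $ i $ l * r i * w l x y) +
      (\<Sum>i\<in>UNIV. \<Sum>l\<in>UNIV. a x $ i $ l * u i x y * s l)"
    by (rule bilinear_parallel[OF a_sym[OF xy(1)] metric_compatible[OF open_U riem xy(1)] du dw])
  finally show ?thesis .
qed

section \<open>The square of the conformal factor in explicit form, and Euler's relations\<close>

abbreviation q where
  "q x y \<equiv> (F x y)\<^sup>2 / ((H x)\<^sup>2 * (\<Sum>i\<in>UNIV. \<Sum>j\<in>UNIV. a x $ i $ j * t x y $ i * t x y $ j))"

lemma norm_t_pos: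
  assumes "x \<in> U" "y \<noteq> 0"
  shows "(\<Sum>i\<in>UNIV. \<Sum>j\<in>UNIV. a x $ i $ j * t x y $ i * t x y $ j) > 0"
proof -
  have "pos_def (a x)"
    using riem assms by (simp add: riemannian_metric_def)
  then have "0 < t x y \<bullet> (a x *v t x y)"
    using t_nonzero[OF assms] by (simp add: pos_def_def)
  then show ?thesis
    by (simp add: inner_vec_def matrix_vector_mult_def sum_distrib_left ac_simps)
qed

lemma H_pos: "x \<in> U \<Longrightarrow> H x > 0"
  using conf by (simp add: conformally_automorphic_via_def)

lemma euler_t:
  assumes "x \<in> U" "y \<noteq> 0"
  shows "(\<Sum>m\<in>UNIV. y $ m * T i m x y) = H x * t x y $ i"
proof (rule euler_field[OF open_U smooth_t assms])
  show "t x (k *\<^sub>R y) $ i = k powr H x * t x y $ i" if "k > 0" for k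
    using conf assms that by (simp add: conformally_automorphic_via_def)
  show "((\<lambda>k. k powr H x) has_field_derivative H x) (at 1)"
    by (auto intro!: derivative_eq_intros)
qed

text \<open>Euler's relation for the square of \<open>F\<close>, of degree 2, is differentiated once
  in \<open>y\<close> to reach second derivatives; contracting with \<open>y\<close> and using the
  relation again gives the claim.\<close>

lemma euler_g:
  assumes "x \<in> U" "y \<noteq> 0"
  shows "(\<Sum>m\<in>UNIV. \<Sum>n\<in>UNIV. g m n x y * y $ m * y $ n) = (F x y)\<^sup>2"
proof -
  let ?E = "\<lambda>x y. (F x y)\<^sup>2"
  have 1: "(\<Sum>n\<in>UNIV. y $ n * dy n ?E x y) = 2 * ?E x y" if "x \<in> U" "y \<noteq> 0" for x y
  proof (rule euler_field[OF open_U smooth_F2 that])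
    show "(F x (k *\<^sub>R y))\<^sup>2 = k\<^sup>2 * (F x y)\<^sup>2" if "k > 0" for k
      using finsler that \<open>x \<in> U\<close> \<open>y \<noteq> 0\<close> by (simp add: finsler_metric_def power_mult_distrib)
    show "((\<lambda>k::real. k\<^sup>2) has_field_derivative 2) (at 1)"
      by (auto intro!: derivative_eq_intros)
  qed
  have "(\<Sum>n\<in>UNIV. y $ n * dy m (dy n ?E) x y) = dy m ?E x y" for m
  proof -
    have y: "dy m (\<lambda>x y. y $ n) x y = (if m = n then 1 else 0)" for n
      using dy_eq_fderiv[OF smooth_field_snd_component[OF open_U] assms] by (simp add: fderiv_snd_component)
    have "dy m (\<lambda>x y. \<Sum>n\<in>UNIV. y $ n * dy n ?E x y) x y = dy m (\<lambda>x y. 2 * ?E x y) x y"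
    proof (rule dy_cong[OF open_U _ _ assms])
      show "(\<Sum>n\<in>UNIV. y $ n * dy n ?E x y) = 2 * ?E x y" if "x \<in> U" "y \<noteq> 0" for x y
        by (rule 1[OF that])
    qed (intro smooth_intros smooth_F2)
    then show ?thesis
      by (simp add: dy_cmult[OF open_U _ assms] dy_sum[OF open_U _ assms] dy_mult[OF open_U _ _ assms]
          smooth_intros smooth_F2 y sum.distrib if_distrib[of "\<lambda>u. u * _"] cong: if_cong)
  qed
  then have "(\<Sum>m\<in>UNIV. y $ m * (\<Sum>n\<in>UNIV. y $ n * dy m (dy n ?E) x y)) = 2 * ?E x y"
    using 1[OF assms] by simp
  moreover have "(\<Sum>m\<in>UNIV. \<Sum>n\<in>UNIV. g m n x y * y $ m * y $ n) =
      1/2 * (\<Sum>m\<in>UNIV. y $ m * (\<Sum>n\<in>UNIV. y $ n * dy m (dy n ?E) x y))"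
    by (simp add: metric_tensor_def sum_distrib_left ac_simps)
  ultimately show ?thesis by simp
qed

text \<open>Contracting the conformality condition with \<open>y\<^sup>m y\<^sup>n\<close> determines \<open>p\<^sup>2\<close>, and thereby its smoothness.\<close>

lemma g_eq:
  assumes "x \<in> U" "y \<noteq> 0"
  shows "g m n x y = q x y * (\<Sum>i\<in>UNIV. \<Sum>j\<in>UNIV. a x $ i $ j * T i m x y * T j n x y)"
proof -
  obtain p where "p > 0"
    and p: "\<And>m n. g m n x y = p\<^sup>2 * (\<Sum>i\<in>UNIV. \<Sum>j\<in>UNIV. a x $ i $ j * T i m x y * T j n x y)"
    by (rule conformal_factor[OF assms]) (rule that)
  have "(F x y)\<^sup>2 = (\<Sum>m\<in>UNIV. \<Sum>n\<in>UNIV. \<Sum>i\<in>UNIV. \<Sum>j\<in>UNIV.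
      p\<^sup>2 * a x $ i $ j * (y $ m * T i m x y) * (y $ n * T j n x y))"
    \<comment> \<open>The sums are now reordered until each Jacobian entry stands next to the
      component of \<open>y\<close> contracted with it; \<open>euler_t\<close> then turns each
      contraction into \<open>H x\<close> times a component of \<open>t\<close>.\<close>
    by (simp add: euler_g[OF assms, symmetric] p sum_distrib_left sum_distrib_right ac_simps)
  also have "\<dots> = (\<Sum>m\<in>UNIV. \<Sum>i\<in>UNIV. \<Sum>n\<in>UNIV. \<Sum>j\<in>UNIV.
      p\<^sup>2 * a x $ i $ j * (y $ m * T i m x y) * (y $ n * T j n x y))"
    by (intro sum.cong refl sum.swap)
  also have "\<dots> = (\<Sum>i\<in>UNIV. \<Sum>m\<in>UNIV. \<Sum>n\<in>UNIV. \<Sum>j\<in>UNIV.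
      p\<^sup>2 * a x $ i $ j * (y $ m * T i m x y) * (y $ n * T j n x y))"
    by (rule sum.swap)
  also have "\<dots> = (\<Sum>i\<in>UNIV. \<Sum>m\<in>UNIV. \<Sum>j\<in>UNIV. \<Sum>n\<in>UNIV.
      p\<^sup>2 * a x $ i $ j * (y $ m * T i m x y) * (y $ n * T j n x y))"
    by (intro sum.cong refl sum.swap)
  also have "\<dots> = (\<Sum>i\<in>UNIV. \<Sum>j\<in>UNIV. \<Sum>m\<in>UNIV. \<Sum>n\<in>UNIV.
      p\<^sup>2 * a x $ i $ j * (y $ m * T i m x y) * (y $ n * T j n x y))"
    by (intro sum.cong refl sum.swap)
  also have "\<dots> = (\<Sum>i\<in>UNIV. \<Sum>j\<in>UNIV. p\<^sup>2 * a x $ i $ j *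
      (\<Sum>m\<in>UNIV. y $ m * T i m x y) * (\<Sum>n\<in>UNIV. y $ n * T j n x y))"
    unfolding mult.assoc[of "_ * _" "sum _ _"] sum_product by (simp only: sum_distrib_left mult.assoc)
  also have "\<dots> = p\<^sup>2 * ((H x)\<^sup>2 * (\<Sum>i\<in>UNIV. \<Sum>j\<in>UNIV. a x $ i $ j * t x y $ i * t x y $ j))"
    by (simp add: euler_t[OF assms] sum_distrib_left power2_eq_square ac_simps)
  finally have "p\<^sup>2 = q x y"
    using norm_t_pos[OF assms] H_pos[OF assms(1)] by simp
  then show ?thesis by (simp add: p)
qed

section \<open>Horizontal constancy of the conformal factor and of the metric\<close>

context
  assumes dF: "\<forall>m. \<forall>x\<in>U. \<forall>y. y \<noteq> 0 \<longrightarrow> d_op a t m F x y = 0"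
    and H_const: "H constant_on U"
begin

lemma smooth_q: "smooth_field U q"
proof -
  obtain h where h: "\<And>x. x \<in> U \<Longrightarrow> H x = h"
    using H_const by (auto simp: constant_on_def)
  \<comment> \<open>The constancy of \<open>H\<close> on \<open>U\<close> is what makes it a smooth
    field.\<close>
  have sH: "smooth_field U (\<lambda>x y. H x)"
    by (rule smooth_field_cong[OF open_U _ smooth_field_const[OF open_U]]) (simp add: h)
  have "H x * H x * (\<Sum>i\<in>UNIV. \<Sum>j\<in>UNIV. a x $ i $ j * t x y $ i * t x y $ j) \<noteq> 0"
    if "x \<in> U" "y \<noteq> 0" for x y
    using norm_t_pos[OF that] H_pos[OF that(1)] by simp
  then show ?thesis
    unfolding power2_eq_square by (intro smooth_intros smooth_F smooth_a smooth_t sH)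
qed

text \<open>Instead of a quotient, the product identity between \<open>q\<close>, the squared length
  of \<open>t\<close> and the square of \<open>F\<close> is differentiated. The length is constant
  by \<open>d_op_t\<close> and metric compatibility, \<open>F\<close> by assumption; the positive
  factors are then cancelled.\<close>

lemma d_op_q:
  assumes "x \<in> U" "y \<noteq> 0"
  shows "d_op a t m q x y = 0"
proof -
  let ?A = "\<lambda>x y. \<Sum>i\<in>UNIV. \<Sum>j\<in>UNIV. a x $ i $ j * t x y $ i * t x y $ j"
  obtain h where h: "\<And>x. x \<in> U \<Longrightarrow> H x = h"
    using H_const by (auto simp: constant_on_def)
  have sA: "smooth_field U ?A"
    by (intro smooth_intros smooth_a smooth_t)
  have dA: "d_op a t m ?A x y = 0"
    using d_op_bilinear[OF assms smooth_t smooth_t, where r = "\<lambda>_. 0" and s = "\<lambda>_. 0"] d_op_t[OF assms] by simp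
  have "d_op a t m (\<lambda>x y. h\<^sup>2 * (q x y * ?A x y)) x y = d_op a t m (\<lambda>x y. F x y * F x y) x y"
  proof (rule d_op_cong[OF open_U _ _ assms])
    show "h\<^sup>2 * (q x y * ?A x y) = F x y * F x y" if "x \<in> U" "y \<noteq> 0" for x y
      using norm_t_pos[OF that] H_pos[OF that(1)] h[OF that(1)] by (simp add: power2_eq_square)
    show "smooth_field U (\<lambda>x y. h\<^sup>2 * (q x y * ?A x y))"
      by (intro smooth_field_mult[OF open_U] smooth_field_const[OF open_U] smooth_q sA)
  qed
  moreover have "d_op a t m (\<lambda>x y. h\<^sup>2 * (q x y * ?A x y)) x y = h\<^sup>2 * (d_op a t m q x y * ?A x y)"
    using d_op_cmult[OF open_U smooth_field_mult[OF open_U smooth_q sA] assms, of a t m "h\<^sup>2"]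
      d_op_mult[OF open_U smooth_q sA assms, of a t m] dA by simp
  moreover have "d_op a t m (\<lambda>x y. F x y * F x y) x y = 0"
    using d_op_mult[OF open_U smooth_F smooth_F assms, of a t m] dF assms by simp
  ultimately have "h\<^sup>2 * (d_op a t m q x y * ?A x y) = 0"
    by simp
  then show ?thesis
    using norm_t_pos[OF assms] H_pos[OF assms(1)] h[OF assms(1)] by simp
qed

text \<open>Covariant constancy of \<open>g\<close>, written out. As \<open>q\<close> is
  horizontally constant, only the \<open>conn2\<close> remainders of the two Jacobian columns
  contribute.\<close>

lemma d_op_g:
  assumes "x \<in> U" "y \<noteq> 0"
  shows "d_op a t m (g j n) x y =
    - ((\<Sum>k\<in>UNIV. conn2 a t k m j x y * g k n x y) + (\<Sum>k\<in>UNIV. conn2 a t k m n x y * g j k x y))"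
proof -
  let ?B = "\<lambda>j n x y. \<Sum>i\<in>UNIV. \<Sum>l\<in>UNIV. a x $ i $ l * T i j x y * T l n x y"
  have sB: "smooth_field U (?B j n)"
    by (intro smooth_intros smooth_a smooth_t)
  have "d_op a t m (g j n) x y = d_op a t m (\<lambda>x y. q x y * ?B j n x y) x y"
    by (rule d_op_cong[OF open_U g_eq smooth_g assms])
  also have "\<dots> = q x y * d_op a t m (?B j n) x y"
    using d_op_mult[OF open_U smooth_q sB assms, of a t m] d_op_q[OF assms] by simp
  also have "d_op a t m (?B j n) x y =
      (\<Sum>i\<in>UNIV. \<Sum>l\<in>UNIV. a x $ i $ l * (- (\<Sum>k\<in>UNIV. conn2 a t k m j x y * T i k x y)) * T l n x y) +
      (\<Sum>i\<in>UNIV. \<Sum>l\<in>UNIV. a x $ i $ l * T i j x y * (- (\<Sum>k\<in>UNIV. conn2 a t k m n x y * T l k x y)))"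
    by (rule d_op_bilinear[OF assms smooth_T smooth_T]) (rule d_op_T[OF assms])+
  also have "(\<Sum>i\<in>UNIV. \<Sum>l\<in>UNIV. a x $ i $ l * (- (\<Sum>k\<in>UNIV. conn2 a t k m j x y * T i k x y)) * T l n x y)
      = - (\<Sum>k\<in>UNIV. conn2 a t k m j x y * ?B k n x y)"
  proof -
    have "(\<Sum>k\<in>UNIV. conn2 a t k m j x y * ?B k n x y) =
        (\<Sum>k\<in>UNIV. \<Sum>i\<in>UNIV. \<Sum>l\<in>UNIV. a x $ i $ l * (conn2 a t k m j x y * T i k x y) * T l n x y)"
      by (simp add: sum_distrib_left ac_simps)
    also have "\<dots> = (\<Sum>i\<in>UNIV. \<Sum>k\<in>UNIV. \<Sum>l\<in>UNIV. a x $ i $ l * (conn2 a t k m j x y * T i k x y) * T l n x y)"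
      by (rule sum.swap)
    also have "\<dots> = (\<Sum>i\<in>UNIV. \<Sum>l\<in>UNIV. \<Sum>k\<in>UNIV. a x $ i $ l * (conn2 a t k m j x y * T i k x y) * T l n x y)"
      by (intro sum.cong refl sum.swap)
    finally show ?thesis
      by (simp add: sum_distrib_left sum_distrib_right sum_negf)
  qed
  also have "(\<Sum>i\<in>UNIV. \<Sum>l\<in>UNIV. a x $ i $ l * T i j x y * (- (\<Sum>k\<in>UNIV. conn2 a t k m n x y * T l k x y)))
      = - (\<Sum>k\<in>UNIV. conn2 a t k m n x y * ?B j k x y)"
  proof -
    have "(\<Sum>k\<in>UNIV. conn2 a t k m n x y * ?B j k x y) =
        (\<Sum>k\<in>UNIV. \<Sum>i\<in>UNIV. \<Sum>l\<in>UNIV. a x $ i $ l * T i j x y * (conn2 a t k m n x y * T l k x y))"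
      by (simp add: sum_distrib_left ac_simps)
    also have "\<dots> = (\<Sum>i\<in>UNIV. \<Sum>k\<in>UNIV. \<Sum>l\<in>UNIV. a x $ i $ l * T i j x y * (conn2 a t k m n x y * T l k x y))"
      by (rule sum.swap)
    also have "\<dots> = (\<Sum>i\<in>UNIV. \<Sum>l\<in>UNIV. \<Sum>k\<in>UNIV. a x $ i $ l * T i j x y * (conn2 a t k m n x y * T l k x y))"
      by (intro sum.cong refl sum.swap)
    finally show ?thesis
      by (simp add: sum_distrib_left sum_negf)
  qed
  \<comment> \<open>Moving \<open>q\<close> back inside the sums rebuilds the components of
    \<open>g\<close>.\<close>
  also have "q x y * (- (\<Sum>k\<in>UNIV. conn2 a t k m j x y * ?B k n x y) + - (\<Sum>k\<in>UNIV. conn2 a t k m n x y * ?B j k x y)) =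
      - ((\<Sum>k\<in>UNIV. conn2 a t k m j x y * (q x y * ?B k n x y)) + (\<Sum>k\<in>UNIV. conn2 a t k m n x y * (q x y * ?B j k x y)))"
  proof -
    have "(\<Sum>k\<in>UNIV. u k * (c * v k)) = c * (\<Sum>k\<in>UNIV. u k * v k)" for c :: real and u v :: "'n \<Rightarrow> real"
      by (simp add: sum_distrib_left ac_simps)
    then show ?thesis
      by (simp only: distrib_left mult_minus_right minus_add_distrib)
  qed
  finally show ?thesis
    by (simp only: g_eq[OF assms, symmetric])
qed

section \<open>The Cartan tensor with lowered indices and its covariant derivative\<close>

lemma smooth_cartan: "smooth_field U (cartan F j n h)"
  unfolding cartan_def[abs_def] by (intro smooth_intros smooth_g) simp

lemma cartan_swap12:
  assumes "x \<in> U" "y \<noteq> 0"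
  shows "cartan F j n h x y = cartan F n j h x y"
  using dy_cong[OF open_U g_sym smooth_g assms] by (simp add: cartan_def)

text \<open>The Cartan tensor is one quarter of the third \<open>y\<close>-derivative of the square
  of \<open>F\<close>, and \<open>y\<close>-derivatives commute.\<close>

lemma cartan_swap23:
  assumes "x \<in> U" "y \<noteq> 0"
  shows "cartan F j n h x y = cartan F j h n x y"
proof -
  let ?E = "\<lambda>x y. (F x y)\<^sup>2"
  have third: "cartan F j n h x y = 1/4 * dy h (dy n (dy j ?E)) x y" for n h
  proof -
    have "dy h (g j n) x y = dy h (\<lambda>x y. 1/2 * dy n (dy j ?E) x y) x y"
      by (rule dy_cong[OF open_U _ smooth_g assms])
         (simp add: metric_tensor_def dy_commute[OF open_U smooth_F2])
    also have "\<dots> = 1/2 * dy h (dy n (dy j ?E)) x y"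
      by (rule dy_cmult[OF open_U _ assms]) (intro smooth_intros smooth_F2)
    finally show ?thesis by (simp add: cartan_def)
  qed
  have "dy h (dy n (dy j ?E)) x y = dy n (dy h (dy j ?E)) x y"
    by (rule dy_commute[OF open_U _ assms]) (intro smooth_intros smooth_F2)
  then show ?thesis
    by (simp only: third)
qed

text \<open>\<open>cov_cartan\<close> with its first index lowered. Lower indices enter with a plus
  sign, according to the sign convention of \<open>conn\<close>.\<close>

definition cov_cartan_low where
  "cov_cartan_low m j n h x y = d_op a t m (cartan F j n h) x y
    + (\<Sum>s\<in>UNIV. conn2 a t s m j x y * cartan F s n h x y)
    + (\<Sum>s\<in>UNIV. conn2 a t s m n x y * cartan F j s h x y)
    + (\<Sum>s\<in>UNIV. conn2 a t s m h x y * cartan F j n s x y)"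

lemma cov_cartan_low_swap12:
  assumes "x \<in> U" "y \<noteq> 0"
  shows "cov_cartan_low m j n h x y = cov_cartan_low m n j h x y"
proof -
  have "cartan F s n h x y = cartan F n s h x y" "cartan F j s h x y = cartan F s j h x y"
    "cartan F j n s x y = cartan F n j s x y" for s
    by (rule cartan_swap12[OF assms])+
  then show ?thesis
    using d_op_cong[OF open_U cartan_swap12 smooth_cartan assms, of a t m j n h]
    by (simp add: cov_cartan_low_def)
qed

lemma cov_cartan_low_swap23:
  assumes "x \<in> U" "y \<noteq> 0"
  shows "cov_cartan_low m j n h x y = cov_cartan_low m j h n x y"
proof -
  have "cartan F s n h x y = cartan F s h n x y" "cartan F j s h x y = cartan F j h s x y"
    "cartan F j n s x y = cartan F j s n x y" for s
    by (rule cartan_swap23[OF assms])+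
  then show ?thesis
    using d_op_cong[OF open_U cartan_swap23 smooth_cartan assms, of a t m j n h]
    by (simp add: cov_cartan_low_def)
qed

lemma conn3_swap:
  assumes "x \<in> U" "y \<noteq> 0"
  shows "conn3 a t k m n h x y = conn3 a t k m h n x y"
  unfolding conn3_def conn2_def by (rule dy_commute[OF open_U smooth_conn assms])

text \<open>In the \<open>y\<close>-derivative of \<open>d_op_g\<close>, the terms where
  \<open>g\<close> is differentiated, together with the commutator term of \<open>dy_d_op\<close>,
  assemble to the covariant derivative; the right-hand side is what arises where
  \<open>conn2\<close> is differentiated.\<close>

lemma cov_cartan_low_conn3:
  assumes "x \<in> U" "y \<noteq> 0"
  shows "2 * cov_cartan_low m j n h x y =
    - ((\<Sum>k\<in>UNIV. g n k x y * conn3 a t k m j h x y) + (\<Sum>k\<in>UNIV. g j k x y * conn3 a t k m n h x y))"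
proof -
  have dg: "dy h (g j n) = (\<lambda>x y. 2 * cartan F j n h x y)" for j n h
    by (simp add: cartan_def fun_eq_iff)
  have "dy h (d_op a t m (g j n)) x y = dy h (\<lambda>x y. - ((\<Sum>k\<in>UNIV. conn2 a t k m j x y * g k n x y)
      + (\<Sum>k\<in>UNIV. conn2 a t k m n x y * g j k x y))) x y"
    by (rule dy_cong[OF open_U d_op_g smooth_field_d_op[OF open_U smooth_conn smooth_g] assms])
  also have "\<dots> = - ((\<Sum>k\<in>UNIV. conn2 a t k m j x y * (2 * cartan F k n h x y) + conn3 a t k m j h x y * g k n x y)
      + (\<Sum>k\<in>UNIV. conn2 a t k m n x y * (2 * cartan F j k h x y) + conn3 a t k m n h x y * g j k x y))"
    by (simp add: dy_uminus[OF open_U _ assms] dy_add[OF open_U _ _ assms] dy_sum[OF open_U _ assms]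
        dy_mult[OF open_U _ _ assms] smooth_intros smooth_conn2 smooth_g dg conn3_def
        del: minus_add_distrib)
  finally have "dy h (d_op a t m (g j n)) x y = \<dots>" .
  moreover have "dy h (d_op a t m (g j n)) x y =
      2 * d_op a t m (cartan F j n h) x y + (\<Sum>k\<in>UNIV. conn2 a t k m h x y * (2 * cartan F j n k x y))"
    using dy_d_op[OF open_U smooth_conn smooth_g assms, of h m j n] d_op_cmult[OF open_U smooth_cartan assms]
    by (simp add: dg)
  moreover have "(\<Sum>k\<in>UNIV. u k * (2 * v k)) = 2 * (\<Sum>k\<in>UNIV. u k * v k)" for u v :: "'n \<Rightarrow> real"
    by (simp add: sum_distrib_left ac_simps)
  ultimately show ?thesis
    by (simp add: cov_cartan_low_def sum.distrib g_sym[OF assms, of _ n] mult.commute[of "conn3 a t _ _ _ _ _ _"])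
qed

text \<open>The Christoffel trick: a tensor symmetric in its last two indices is recovered from its
  symmetrisation in the first two.\<close>

lemma conn3_lower:
  assumes "x \<in> U" "y \<noteq> 0"
  shows "(\<Sum>k\<in>UNIV. g l k x y * conn3 a t k m n j x y) = - cov_cartan_low m l n j x y"
proof -
  have sym: "(\<Sum>k\<in>UNIV. g l k x y * conn3 a t k m n j x y) = (\<Sum>k\<in>UNIV. g l k x y * conn3 a t k m j n x y)" for l n j
    by (simp add: conn3_swap[OF assms, of _ _ n j])
  \<comment> \<open>The first two instances of \<open>cov_cartan_low_conn3\<close> minus the third
    isolate the contraction with \<open>g l k\<close>; by total symmetry their left-hand sides are
    all equal.\<close>
  show ?thesis
    using cov_cartan_low_conn3[OF assms, of m n l j] cov_cartan_low_conn3[OF assms, of m j l n]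
      cov_cartan_low_conn3[OF assms, of m n j l]
      sym[of l n j] sym[of n l j] sym[of j l n]
      cov_cartan_low_swap12[OF assms, of m n l j] cov_cartan_low_swap12[OF assms, of m j l n]
      cov_cartan_low_swap23[OF assms, of m l j n] cov_cartan_low_swap23[OF assms, of m n j l]
    by linarith
qed

section \<open>Passage to the mixed Cartan tensor\<close>

lemma smooth_cartan_up: "smooth_field U (cartan_up F k n j)"
  unfolding cartan_up_def[abs_def]
  by (intro smooth_intros smooth_cartan smooth_field_matrix_inv[OF open_U] smooth_g pos_def_invertible pos_def_g)

lemma cartan_up_lower:
  assumes "x \<in> U" "y \<noteq> 0"
  shows "(\<Sum>k\<in>UNIV. g l k x y * cartan_up F k n j x y) = cartan F l n j x y"
proof -
  have "(\<Sum>k\<in>UNIV. g l k x y * cartan_up F k n j x y) =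
      (\<Sum>k\<in>UNIV. \<Sum>h\<in>UNIV. g l k x y * matrix_inv (metric_tensor F x y) $ k $ h * cartan F h n j x y)"
    by (simp add: cartan_up_def sum_distrib_left mult.assoc)
  also have "\<dots> = (\<Sum>h\<in>UNIV. (\<Sum>k\<in>UNIV. g l k x y * matrix_inv (metric_tensor F x y) $ k $ h) * cartan F h n j x y)"
    by (subst sum.swap) (simp add: sum_distrib_right)
  also have "\<dots> = cartan F l n j x y"
    by (simp add: sum_matrix_inv[OF pos_def_invertible[OF pos_def_g[OF assms]]]
        if_distrib[of "\<lambda>u. u * _"] cong: if_cong)
  finally show ?thesis .
qed

text \<open>By \<open>d_op_g\<close> the metric is covariantly constant, so lowering an index
  commutes with the covariant derivative.\<close>

lemma cov_cartan_lower:
  assumes "x \<in> U" "y \<noteq> 0"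
  shows "(\<Sum>k\<in>UNIV. g l k x y * cov_cartan F a t m k n j x y) = cov_cartan_low m l n j x y"
proof -
  let ?C = "\<lambda>k n j. cartan_up F k n j x y" and ?N = "\<lambda>k n. conn2 a t k m n x y"
  have swap: "(\<Sum>k\<in>UNIV. u k * (\<Sum>s\<in>UNIV. v s * w k s)) = (\<Sum>s\<in>UNIV. v s * (\<Sum>k\<in>UNIV. u k * w k s))"
    for u v :: "'n \<Rightarrow> real" and w
    unfolding sum_distrib_left by (subst sum.swap) (simp add: ac_simps)
  have "d_op a t m (cartan F l n j) x y = d_op a t m (\<lambda>x y. \<Sum>k\<in>UNIV. g l k x y * cartan_up F k n j x y) x y"
    by (rule d_op_cong[OF open_U _ smooth_cartan assms]) (simp add: cartan_up_lower)
  also have "\<dots> = (\<Sum>k\<in>UNIV. g l k x y * d_op a t m (cartan_up F k n j) x y) +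
      (\<Sum>k\<in>UNIV. d_op a t m (g l k) x y * ?C k n j)"
    by (simp add: d_op_sum[OF open_U _ assms] d_op_mult[OF open_U _ _ assms] smooth_intros smooth_g
        smooth_cartan_up sum.distrib)
  \<comment> \<open>Of the two sums from \<open>d_op_g\<close>, the first becomes the term for the
    lower index \<open>l\<close>; the second will cancel the minus term of the upper index in
    \<open>cov_cartan\<close>.\<close>
  also have "(\<Sum>k\<in>UNIV. d_op a t m (g l k) x y * ?C k n j) =
      - (\<Sum>k\<in>UNIV. ?C k n j * (\<Sum>s\<in>UNIV. ?N s l * g s k x y)) - (\<Sum>k\<in>UNIV. ?C k n j * (\<Sum>s\<in>UNIV. ?N s k * g l s x y))"
    by (simp add: d_op_g[OF assms] distrib_right sum.distrib sum_negf sum_subtractf left_diff_distrib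
        mult.commute[of "?C _ _ _"])
  also have "(\<Sum>k\<in>UNIV. ?C k n j * (\<Sum>s\<in>UNIV. ?N s l * g s k x y)) = (\<Sum>s\<in>UNIV. ?N s l * cartan F s n j x y)"
    by (subst swap) (simp add: mult.commute[of "?C _ _ _"] cartan_up_lower[OF assms])
  also have "(\<Sum>k\<in>UNIV. ?C k n j * (\<Sum>s\<in>UNIV. ?N s k * g l s x y)) =
      (\<Sum>s\<in>UNIV. g l s x y * (\<Sum>k\<in>UNIV. ?N s k * ?C k n j))"
    unfolding sum_distrib_left by (subst sum.swap) (simp add: ac_simps)
  finally have 1: "(\<Sum>k\<in>UNIV. g l k x y * d_op a t m (cartan_up F k n j) x y) =
      d_op a t m (cartan F l n j) x y + (\<Sum>s\<in>UNIV. ?N s l * cartan F s n j x y) +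
      (\<Sum>k\<in>UNIV. g l k x y * (\<Sum>s\<in>UNIV. ?N k s * ?C s n j))"
    by simp
  have 2: "(\<Sum>k\<in>UNIV. g l k x y * (\<Sum>s\<in>UNIV. ?N s n * ?C k s j)) = (\<Sum>s\<in>UNIV. ?N s n * cartan F l s j x y)"
    and 3: "(\<Sum>k\<in>UNIV. g l k x y * (\<Sum>s\<in>UNIV. ?N s j * ?C k n s)) = (\<Sum>s\<in>UNIV. ?N s j * cartan F l n s x y)"
    by (subst swap, simp add: cartan_up_lower[OF assms])+
  show ?thesis
    by (simp only: cov_cartan_def cov_cartan_low_def distrib_left right_diff_distrib sum.distrib sum_subtractf 1 2 3)
qed

text \<open>Both sides agree after lowering the index \<open>k\<close>, and \<open>g\<close> is
  nondegenerate.\<close>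

lemma conn3_eq_cov_cartan:
  assumes "x \<in> U" "y \<noteq> 0"
  shows "conn3 a t k m n j x y = - cov_cartan F a t m k n j x y"
proof -
  have "(\<Sum>k\<in>UNIV. g l k x y * (conn3 a t k m n j x y + cov_cartan F a t m k n j x y)) = 0" for l
    using conn3_lower[OF assms, of l m n j] cov_cartan_lower[OF assms, of l m n j]
    by (simp add: distrib_left sum.distrib)
  from pos_def_kernel[OF pos_def_g[OF assms] this] show ?thesis
    by (metis eq_neg_iff_add_eq_0)
qed

end

end

theorem proposition3p2:
  fixes U :: "(real^'n) set"
    and F :: "real^'n \<Rightarrow> real^'n \<Rightarrow> real"
    and a :: "real^'n \<Rightarrow> real^'n^'n"
    and H :: "real^'n \<Rightarrow> real"
    and t :: "real^'n \<Rightarrow> real^'n \<Rightarrow> real^'n"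
  assumes dim: "CARD('n) \<ge> 3"
    and "open U"
    and "finsler_metric U F"
    and "riemannian_metric U a"
    and "conformally_automorphic_via U F a H t"
    and dF: "\<forall>m. \<forall>x\<in>U. \<forall>y. y \<noteq> 0 \<longrightarrow> d_op a t m F x y = 0"
    and H_const: "H constant_on U"
  shows "\<forall>k m n j. \<forall>x\<in>U. \<forall>y. y \<noteq> 0 \<longrightarrow>
           conn3 a t k m n j x y = - cov_cartan F a t m k n j x y"
  using conn3_eq_cov_cartan[OF assms(2-7)] by blast

end
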